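(* Let $u_1,\dots,u_N$ be coherent utility functions with weakly compact determining sets $\mathcal D_1,\dots,\mathcal D_N$, let $A_n\subseteq L^0$ be a $\mathcal D_n$-consistent convex cone (containing $0$) and $W_n\in L^1_s(\mathcal D_n)$, $n=1,\dots,N$. Put $\mathcal D=\bigcap_n\mathcal D_n$, $W=\sum_nW_n$, and assume that $M<\infty$, where $$M=\sup\Bigl\{\sum_{n=1}^Nu_n(W_n+X_n+Y_n):\ X_n\in A_n,\ Y_n\in L^1_s(\mathcal D),\ \sum_nY_n=0\Bigr\}$$ (the sum being $-\infty$ if any summand is $-\infty$). Let $X_n\in A_n$, $Y_n\in L^1_s(\mathcal D)$, $\sum_nY_n=0$, and write $X=(X_1,\dots,X_N)$, $Y=(Y_1,\dots,Y_N)$. The following conditions are equivalent: (i) $(X,Y)$ is a Pareto-type equilibrium; (ii) there exist $\mathsf Q\in\mathcal P$ and $Y'\sim Y$ such that $(X,Y',\mathsf Q)$ is an Arrow–Debreu-type equilibrium. If these conditions are satisfied, then $$\mathcal E(X,Y)=\mathcal X_{\bigcap_n(\mathcal D_n\cap\mathcal R(A_n))}(W),$$ where $\mathcal E(X,Y)=\{\mathsf Q\in\mathcal P:\exists Y'\sim Y\text{ such that }(X,Y',\mathsf Q)\text{ is an Arrow–Debreu-type equilibrium}\}$. If each $A_n$ is a linear space, then (i), (ii) are equivalent to: (iii) $\bigcap_n\bigl(\mathcal X_{\mathcal D_n}(W_n+X_n+Y_n)\cap\mathcal R(A_n)\bigr)\ne\emptyset$. Moreover, in this case $$\mathcal E(X,Y)=\bigcap_{n=1}^N\bigl(\mathcal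 X_{\mathcal D_n}(W_n+X_n+Y_n)\cap\mathcal R(A_n)\bigr).$$
   Context: $(\Omega,\mathcal F,\mathsf P)$ is a probability space, $L^0$ is the space of real random variables, and $\mathcal P$ is the set of probability measures absolutely continuous with respect to $\mathsf P$, identified with their densities in $L^1(\mathsf P)$; weak compactness refers to $\sigma(L^1,L^\infty)$. $\mathsf E_{\mathsf Q}X=\mathsf E_{\mathsf Q}X^+-\mathsf E_{\mathsf Q}X^-$ with $\infty-\infty=-\infty$. A coherent utility function is a map $u:L^0\to[-\infty,\infty]$ of the form $u(X)=\inf_{\mathsf Q\in\mathcal D}\mathsf E_{\mathsf Q}X$ with nonempty $\mathcal D\subset\mathcal P$; its determining set is the largest such $\mathcal D$ (it is convex). $L^1_s(\mathcal D)=\{X\in L^0:\lim_{n\to\infty}\sup_{\mathsf Q\in\mathcal D}\mathsf E_{\mathsf Q}|X|I(|X|>n)=0\}$. For $\mathcal D'\subset\mathcal P$, $\mathcal X_{\mathcal D'}(X)=\{\mathsf Q\in\mathcal D':\mathsf E_{\mathsf Q}X=\inf_{\mathsf Q'\in\mathcal D'}\mathsf E_{\mathsf Q'}X\in(-\infty,\infty)\}$. $\mathcal R(A)=\{\mathsf Q\in\mathcal P:\mathsf E_{\mathsf Q}X\le0\ \forall X\in A\}$; $A$ is $\mathcal D$-consistent if there is $A'\subseteq A\cap L^1_s(\mathcal D)$ with $\mathcal D\cap\mathcal R(A)=\mathcal D\cap\mathcal R(A')$. $(X,Y)=(X_1,\dots,X_N,Y_1,\dots,Y_N)$ is a Pareto-type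 equilibrium if (a) $X_n\in A_n$; (b) $Y_n\in L^1_s(\mathcal D)$, $\sum_nY_n=0$; (c) there is no $(X',Y')$ satisfying (a), (b) with $u_n(W_n+X_n'+Y_n')\ge u_n(W_n+X_n+Y_n)$ for all $n$ and with strict inequality for some $n$. $(X,Y,\mathsf Q)$, with $\mathsf Q\in\mathcal P$, is an Arrow–Debreu-type equilibrium if (a) $X_n\in A_n$; (b) $Y_n\in L^1_s(\mathcal D)$, $\sum_nY_n=0$, $\mathsf E_{\mathsf Q}Y_n=0$ (so that $Y_n\in L^1(\mathsf Q)$); (c) for every $n$, $u_n(W_n+X_n+Y_n)=\max\{u_n(W_n+\xi+\eta):\xi\in A_n,\ \eta\in L^1(\mathsf Q),\ \mathsf E_{\mathsf Q}\eta=0\}$. For $N$-dimensional random vectors, $Y'\sim Y$ means that there are $a_1,\dots,a_N\in\mathbb R$ with $\sum_na_n=0$ and $Y_n'=Y_n+a_n$ for all $n$. *)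

theory Defs
  imports "HOL-Probability.Probability"
begin

text \<open>
  Random variables are represented by measurable real functions rather than by their
  almost-sure classes: \<open>L0 P\<close> contains all representatives, identities between random variables
  are stated almost surely, and every functional below depends only on the almost-sure class.
  Probability measures are represented by measures; their densities enter through \<open>RN_deriv\<close>.
\<close>

definition L0 :: "'a measure \<Rightarrow> ('a \<Rightarrow> real) set" where
  "L0 P = borel_measurable P"

definition ac_probs :: "'a measure \<Rightarrow> 'a measure set" where
  "ac_probs P = {Q. prob_space Q \<and> sets Q = sets P \<and> absolutely_continuous P Q}"

text \<open>The case distinction implements \<open>\<infinity> - \<infinity> = -\<infinity>\<close>; subtraction on \<^typ>\<open>ereal\<close>
  would yield \<open>\<infinity>\<close>.\<close>

definition expec :: "'a measure \<Rightarrow> ('a \<Rightarrow> real) \<Rightarrow> ereal" where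
  "expec Q X =
    (if (\<integral>\<^sup>+x. ennreal (max 0 (- X x)) \<partial>Q) = \<infinity> then - \<infinity>
     else enn2ereal (\<integral>\<^sup>+x. ennreal (max 0 (X x)) \<partial>Q) - enn2ereal (\<integral>\<^sup>+x. ennreal (max 0 (- X x)) \<partial>Q))"

definition Linf :: "'a measure \<Rightarrow> ('a \<Rightarrow> real) set" where
  "Linf P = {g \<in> L0 P. \<exists>C. AE x in P. \<bar>g x\<bar> \<le> C}"

text \<open>The topology \<open>\<sigma>(L\<^sup>1, L\<^sup>\<infinity>)\<close>, on representatives. Its open sets are saturated under almost-sure
  equality, so compactness here agrees with compactness in the quotient.\<close>

definition weak_L1 :: "'a measure \<Rightarrow> ('a \<Rightarrow> real) topology" where
  "weak_L1 P = topology_generated_by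
    {{f. integrable P f \<and> (\<integral>x. f x * g x \<partial>P) \<in> U} | g U. g \<in> Linf P \<and> open U}"

definition weakly_compact :: "'a measure \<Rightarrow> 'a measure set \<Rightarrow> bool" where
  "weakly_compact P D \<longleftrightarrow> compactin (weak_L1 P) ((\<lambda>Q x. enn2real (RN_deriv P Q x)) ` D)"

definition represents :: "'a measure \<Rightarrow> (('a \<Rightarrow> real) \<Rightarrow> ereal) \<Rightarrow> 'a measure set \<Rightarrow> bool" where
  "represents P u D \<longleftrightarrow> D \<noteq> {} \<and> D \<subseteq> ac_probs P \<and> (\<forall>X\<in>L0 P. u X = (INF Q\<in>D. expec Q X))"

definition coherent_utility :: "'a measure \<Rightarrow> (('a \<Rightarrow> real) \<Rightarrow> ereal) \<Rightarrow> bool" where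
  "coherent_utility P u \<longleftrightarrow> (\<exists>D. represents P u D)"

definition determining_set :: "'a measure \<Rightarrow> (('a \<Rightarrow> real) \<Rightarrow> ereal) \<Rightarrow> 'a measure set" where
  "determining_set P u = (GREATEST D. represents P u D)"

text \<open>The supremum is taken in \<^typ>\<open>ennreal\<close>, hence is \<open>0\<close> for empty \<open>D\<close>.\<close>

definition L1s :: "'a measure \<Rightarrow> 'a measure set \<Rightarrow> ('a \<Rightarrow> real) set" where
  "L1s P D = {X \<in> L0 P.
    (\<lambda>n::nat. SUP Q\<in>D. \<integral>\<^sup>+x. ennreal (\<bar>X x\<bar> * indicator {x. \<bar>X x\<bar> > real n} x) \<partial>Q) \<longlonglongrightarrow> 0}"

definition extreme_measures :: "'a measure set \<Rightarrow> ('a \<Rightarrow> real) \<Rightarrow> 'a measure set" where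
  "extreme_measures D X =
    {Q \<in> D. expec Q X = (INF Q'\<in>D. expec Q' X) \<and> - \<infinity> < expec Q X \<and> expec Q X < \<infinity>}"

definition risk_neutral :: "'a measure \<Rightarrow> ('a \<Rightarrow> real) set \<Rightarrow> 'a measure set" where
  "risk_neutral P A = {Q \<in> ac_probs P. \<forall>X\<in>A. expec Q X \<le> 0}"

definition consistent :: "'a measure \<Rightarrow> 'a measure set \<Rightarrow> ('a \<Rightarrow> real) set \<Rightarrow> bool" where
  "consistent P D A \<longleftrightarrow>
    (\<exists>A'. A' \<subseteq> A \<inter> L1s P D \<and> D \<inter> risk_neutral P A = D \<inter> risk_neutral P A')"

text \<open>The function type carries no \<^class>\<open>real_vector\<close> structure, so the library's
  \<open>cone\<close>, \<open>convex\<close> and \<open>subspace\<close> do not apply to sets of random variables.\<close>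

definition rv_convex_cone :: "('a \<Rightarrow> real) set \<Rightarrow> bool" where
  "rv_convex_cone A \<longleftrightarrow> (\<lambda>_. 0) \<in> A
    \<and> (\<forall>X\<in>A. \<forall>c\<ge>0. (\<lambda>x. c * X x) \<in> A)
    \<and> (\<forall>X\<in>A. \<forall>Y\<in>A. \<forall>s\<ge>0. \<forall>t\<ge>0. s + t = 1 \<longrightarrow> (\<lambda>x. s * X x + t * Y x) \<in> A)"

definition rv_linear_space :: "('a \<Rightarrow> real) set \<Rightarrow> bool" where
  "rv_linear_space A \<longleftrightarrow> (\<lambda>_. 0) \<in> A
    \<and> (\<forall>X\<in>A. \<forall>c. (\<lambda>x. c * X x) \<in> A)
    \<and> (\<forall>X\<in>A. \<forall>Y\<in>A. (\<lambda>x. X x + Y x) \<in> A)"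

text \<open>The economy: agents are indexed by \<open>{1..N}\<close>; values of the indexed families outside this
  range are irrelevant.\<close>

definition common_set :: "'a measure \<Rightarrow> nat \<Rightarrow> (nat \<Rightarrow> ('a \<Rightarrow> real) \<Rightarrow> ereal) \<Rightarrow> 'a measure set" where
  "common_set P N u = (\<Inter>n\<in>{1..N}. determining_set P (u n))"

definition feasible ::
  "'a measure \<Rightarrow> nat \<Rightarrow> (nat \<Rightarrow> ('a \<Rightarrow> real) \<Rightarrow> ereal) \<Rightarrow> (nat \<Rightarrow> ('a \<Rightarrow> real) set)
    \<Rightarrow> (nat \<Rightarrow> 'a \<Rightarrow> real) \<Rightarrow> (nat \<Rightarrow> 'a \<Rightarrow> real) \<Rightarrow> bool" where
  "feasible P N u A X Y \<longleftrightarrow>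
    (\<forall>n\<in>{1..N}. X n \<in> A n) \<and> (\<forall>n\<in>{1..N}. Y n \<in> L1s P (common_set P N u))
    \<and> (AE x in P. (\<Sum>n\<in>{1..N}. Y n x) = 0)"

definition utility ::
  "(nat \<Rightarrow> ('a \<Rightarrow> real) \<Rightarrow> ereal) \<Rightarrow> (nat \<Rightarrow> 'a \<Rightarrow> real) \<Rightarrow> nat
    \<Rightarrow> ('a \<Rightarrow> real) \<Rightarrow> ('a \<Rightarrow> real) \<Rightarrow> ereal" where
  "utility u W n \<xi> \<eta> = u n (\<lambda>x. W n x + \<xi> x + \<eta> x)"

text \<open>The case distinction is needed since \<open>\<infinity> + -\<infinity> = \<infinity>\<close> on \<^typ>\<open>ereal\<close>.\<close>

definition total_utility ::
  "nat \<Rightarrow> (nat \<Rightarrow> ('a \<Rightarrow> real) \<Rightarrow> ereal) \<Rightarrow> (nat \<Rightarrow> 'a \<Rightarrow> real)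
    \<Rightarrow> (nat \<Rightarrow> 'a \<Rightarrow> real) \<Rightarrow> (nat \<Rightarrow> 'a \<Rightarrow> real) \<Rightarrow> ereal" where
  "total_utility N u W X Y =
    (if \<exists>n\<in>{1..N}. utility u W n (X n) (Y n) = - \<infinity> then - \<infinity>
     else \<Sum>n\<in>{1..N}. utility u W n (X n) (Y n))"

definition max_total_utility ::
  "'a measure \<Rightarrow> nat \<Rightarrow> (nat \<Rightarrow> ('a \<Rightarrow> real) \<Rightarrow> ereal) \<Rightarrow> (nat \<Rightarrow> 'a \<Rightarrow> real)
    \<Rightarrow> (nat \<Rightarrow> ('a \<Rightarrow> real) set) \<Rightarrow> ereal" where
  "max_total_utility P N u W A = Sup {total_utility N u W X Y | X Y. feasible P N u A X Y}"

definition pareto_equilibrium ::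
  "'a measure \<Rightarrow> nat \<Rightarrow> (nat \<Rightarrow> ('a \<Rightarrow> real) \<Rightarrow> ereal) \<Rightarrow> (nat \<Rightarrow> 'a \<Rightarrow> real)
    \<Rightarrow> (nat \<Rightarrow> ('a \<Rightarrow> real) set) \<Rightarrow> (nat \<Rightarrow> 'a \<Rightarrow> real) \<Rightarrow> (nat \<Rightarrow> 'a \<Rightarrow> real) \<Rightarrow> bool" where
  "pareto_equilibrium P N u W A X Y \<longleftrightarrow>
    feasible P N u A X Y
    \<and> (\<nexists>X' Y'. feasible P N u A X' Y'
        \<and> (\<forall>n\<in>{1..N}. utility u W n (X' n) (Y' n) \<ge> utility u W n (X n) (Y n))
        \<and> (\<exists>n\<in>{1..N}. utility u W n (X' n) (Y' n) > utility u W n (X n) (Y n)))"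

definition attainable ::
  "(nat \<Rightarrow> ('a \<Rightarrow> real) \<Rightarrow> ereal) \<Rightarrow> (nat \<Rightarrow> 'a \<Rightarrow> real) \<Rightarrow> (nat \<Rightarrow> ('a \<Rightarrow> real) set)
    \<Rightarrow> 'a measure \<Rightarrow> nat \<Rightarrow> ereal set" where
  "attainable u W A Q n =
    {utility u W n \<xi> \<eta> | \<xi> \<eta>. \<xi> \<in> A n \<and> integrable Q \<eta> \<and> expec Q \<eta> = 0}"

definition arrow_debreu_equilibrium ::
  "'a measure \<Rightarrow> nat \<Rightarrow> (nat \<Rightarrow> ('a \<Rightarrow> real) \<Rightarrow> ereal) \<Rightarrow> (nat \<Rightarrow> 'a \<Rightarrow> real)
    \<Rightarrow> (nat \<Rightarrow> ('a \<Rightarrow> real) set) \<Rightarrow> (nat \<Rightarrow> 'a \<Rightarrow> real) \<Rightarrow> (nat \<Rightarrow> 'a \<Rightarrow> real) \<Rightarrow> 'a measure \<Rightarrow> bool" where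
  "arrow_debreu_equilibrium P N u W A X Y Q \<longleftrightarrow>
    Q \<in> ac_probs P \<and> feasible P N u A X Y \<and> (\<forall>n\<in>{1..N}. expec Q (Y n) = 0)
    \<and> (\<forall>n\<in>{1..N}. utility u W n (X n) (Y n) \<in> attainable u W A Q n
        \<and> (\<forall>v\<in>attainable u W A Q n. v \<le> utility u W n (X n) (Y n)))"

definition shift_equiv ::
  "'a measure \<Rightarrow> nat \<Rightarrow> (nat \<Rightarrow> 'a \<Rightarrow> real) \<Rightarrow> (nat \<Rightarrow> 'a \<Rightarrow> real) \<Rightarrow> bool" where
  "shift_equiv P N Y' Y \<longleftrightarrow>
    (\<exists>a :: nat \<Rightarrow> real. (\<Sum>n\<in>{1..N}. a n) = 0 \<and> (\<forall>n\<in>{1..N}. AE x in P. Y' n x = Y n x + a n))"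

definition equilibrium_prices ::
  "'a measure \<Rightarrow> nat \<Rightarrow> (nat \<Rightarrow> ('a \<Rightarrow> real) \<Rightarrow> ereal) \<Rightarrow> (nat \<Rightarrow> 'a \<Rightarrow> real)
    \<Rightarrow> (nat \<Rightarrow> ('a \<Rightarrow> real) set) \<Rightarrow> (nat \<Rightarrow> 'a \<Rightarrow> real) \<Rightarrow> (nat \<Rightarrow> 'a \<Rightarrow> real) \<Rightarrow> 'a measure set" where
  "equilibrium_prices P N u W A X Y =
    {Q \<in> ac_probs P. \<exists>Y'. shift_equiv P N Y' Y \<and> arrow_debreu_equilibrium P N u W A X Y' Q}"

end

theory Submission imports Defs begin

text \<open>
  A minimax argument on the weakly compact set \<open>\<Prod>\<^sub>n \<D>\<^sub>n\<close> shows that, if \<open>M < \<infinity>\<close>, some \<open>Q \<in> \<Inter>\<^sub>n (\<D>\<^sub>n \<inter> \<R>(A\<^sub>n))\<close>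
  satisfies \<open>E\<^sub>Q W \<le> M\<close>; as \<open>\<Sum>\<^sub>n u\<^sub>n(W\<^sub>n + X\<^sub>n + Y\<^sub>n) \<le> E\<^sub>Q W\<close> for every such \<open>Q\<close>, \<open>M\<close> is the minimum of \<open>E\<^sub>Q W\<close>.
  Utilities are translation invariant, so constants can be traded freely and Pareto optimality
  means that the total utility is \<open>M\<close>. In that case every minimising \<open>Q\<close> forces equality in each
  summand: \<open>u\<^sub>n(W\<^sub>n + X\<^sub>n + Y\<^sub>n) = E\<^sub>Q (W\<^sub>n + Y\<^sub>n)\<close> and \<open>E\<^sub>Q X\<^sub>n = 0\<close>, which is the Arrow-Debreu property after
  subtracting \<open>E\<^sub>Q Y\<^sub>n\<close> from \<open>Y\<^sub>n\<close>. Conversely, the bound on the utilities over the budget set of an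
  Arrow-Debreu price \<open>Q\<close> can be scaled along rays, which puts \<open>Q\<close> into every \<open>\<D>\<^sub>n \<inter> \<R>(A\<^sub>n)\<close>; buying
  \<open>E\<^sub>Q W\<^sub>n - W\<^sub>n\<close> then shows that the total utility is at least \<open>E\<^sub>Q W \<ge> M\<close>.
\<close>

section \<open>A minimax theorem on compact spaces\<close>

text \<open>The sets \<open>D n\<close> might a priori have no common element, so the minimax step
  has to select one measure per agent; a common price is its outcome, not its search space. Weak
  continuity of expectations is available for claims in \<open>L1s M (D n)\<close>. General
  allocations do not have this regularity: members of \<open>A n\<close> may fail to be integrable,
  and \<open>Y n\<close> is controlled only over the smaller set \<open>common_set M N u\<close>.
  The minimax family is therefore restricted to \<open>X n\<close> in \<open>L1s M (D n)\<close> and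
  bounded \<open>Y n\<close>. Nothing is lost: indicators already separate measures, and consistency
  extends risk neutrality from the regular part of a cone to the whole cone. Arbitrary feasible
  allocations are compared with the resulting price afterwards, by inequalities in
  \<open>ereal\<close> that admit an expectation \<open>-\<infinity>\<close> for \<open>X n\<close>.
  Compactness makes the utility of a regular claim real, and the existence of a price excludes the
  value \<open>\<infinity>\<close> for feasible allocations; once \<open>-\<infinity>\<close> is
  split off, sums of utilities are real sums.\<close>

text \<open>The image of \<open>S\<close> under \<open>(f, g)\<close> is separated from the quadrant below \<open>(c, c)\<close>; the normal of
  the separating line yields the violating convex combination.\<close>

lemma common_sublevel_two:
  assumes "compactin T S" "S \<noteq> {}"
    and f: "continuous_map T euclideanreal f" and g: "continuous_map T euclideanreal g"
    and mix: "\<And>p q t. \<lbrakk>p \<in> S; q \<in> S; 0 \<le> t; t \<le> 1\<rbrakk>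
      \<Longrightarrow> \<exists>r\<in>S. f r = (1 - t) * f p + t * f q \<and> g r = (1 - t) * g p + t * g q"
    and comb: "\<And>t. \<lbrakk>0 \<le> t; t \<le> 1\<rbrakk> \<Longrightarrow> \<exists>p\<in>S. (1 - t) * f p + t * g p \<le> c"
  shows "\<exists>p\<in>S. f p \<le> c \<and> g p \<le> c"
proof (rule ccontr)
  assume neg: "\<not> ?thesis"
  define K where "K = (\<lambda>p. (f p, g p)) ` S"
  define L where "L = {..c} \<times> {..c}"
  have "continuous_map T euclidean (\<lambda>p. (f p, g p))"
    using f g by (simp add: continuous_map_atin tendsto_Pair)
  then have "compact K"
    using image_compactin[OF assms(1), of euclidean "\<lambda>p. (f p, g p)"] by (simp add: K_def)
  moreover have "convex K"
    unfolding K_def convex_alt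
  proof (intro ballI allI impI, elim imageE, clarify)
    fix t :: real and p q assume "0 \<le> t" "t \<le> 1" "p \<in> S" "q \<in> S"
    then obtain r where "r \<in> S" "f r = (1 - t) * f p + t * f q" "g r = (1 - t) * g p + t * g q"
      using mix by blast
    then show "(1 - t) *\<^sub>R (f p, g p) + t *\<^sub>R (f q, g q) \<in> (\<lambda>p. (f p, g p)) ` S"
      by (intro image_eqI[of _ _ r]) auto
  qed
  moreover have "K \<noteq> {}" "K \<inter> L = {}"
    using assms(2) neg by (auto simp: K_def L_def)
  moreover have "convex L" "closed L"
    by (auto simp: L_def intro!: convex_Times closed_Times)
  ultimately obtain a b where ab: "\<And>x. x \<in> K \<Longrightarrow> inner a x < b" "\<And>x. x \<in> L \<Longrightarrow> inner a x > b"
    using separating_hyperplane_compact_closed[of K L] by metis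
  obtain a1 a2 where a: "a = (a1, a2)" by fastforce
  have L: "a1 * x + a2 * y > b" if "x \<le> c" "y \<le> c" for x y
    using ab(2)[of "(x, y)"] that by (simp add: L_def a)
  \<comment> \<open>A linear function that is bounded below on a left half-line cannot have positive
    slope; the minimum in the witness keeps the test point below \<open>c\<close>.\<close>
  have neg1: "d \<le> 0" if "\<And>x. x \<le> c \<Longrightarrow> d * x > e" for d e :: real
  proof (rule ccontr)
    assume d: "\<not> d \<le> 0"
    then have "d * min c (e / d) \<le> d * (e / d)" by (intro mult_left_mono) auto
    also have "\<dots> = e" using d by simp
    finally show False using that[of "min c (e / d)"] by simp
  qed
  have "a1 \<le> 0"
  proof (rule neg1[where d = a1 and e = "b - a2 * c"])
    show "a1 * x > b - a2 * c" if "x \<le> c" for x using L[OF that order_refl] by simp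
  qed
  have "a2 \<le> 0"
  proof (rule neg1[where d = a2 and e = "b - a1 * c"])
    show "a2 * x > b - a1 * c" if "x \<le> c" for x using L[OF order_refl that] by simp
  qed
  have K: "a1 * f p + a2 * g p < b" if "p \<in> S" for p
    using ab(1)[of "(f p, g p)"] that by (auto simp: K_def a)
  have "a1 + a2 \<noteq> 0"
  proof
    assume "a1 + a2 = 0"
    with \<open>a1 \<le> 0\<close> \<open>a2 \<le> 0\<close> have "a1 = 0" "a2 = 0" by linarith+
    then show False using L[of c c] K \<open>S \<noteq> {}\<close> by auto
  qed
  with \<open>a1 \<le> 0\<close> \<open>a2 \<le> 0\<close> have s: "a1 + a2 < 0" by linarith
  \<comment> \<open>Both components of the normal are nonpositive. Dividing by their negative sum
    gives convex weights and reverses the separating inequality.\<close>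
  define t where "t = a2 / (a1 + a2)"
  have t: "0 \<le> t" "t \<le> 1" "1 - t = a1 / (a1 + a2)"
    using s \<open>a1 \<le> 0\<close> \<open>a2 \<le> 0\<close> by (auto simp: t_def divide_simps)
  obtain p where p: "p \<in> S" "(1 - t) * f p + t * g p \<le> c" using comb t by blast
  then have "(a1 * f p + a2 * g p) / (a1 + a2) \<le> c"
    unfolding t(3) by (simp add: t_def add_divide_distrib)
  then have "a1 * f p + a2 * g p \<ge> c * (a1 + a2)" using s by (simp add: neg_divide_le_eq)
  moreover have "c * (a1 + a2) > b" using L[of c c] by (simp add: distrib_left mult.commute)
  ultimately show False using K[OF p(1)] by linarith
qed

text \<open>The finite case peels off one function at a time: the hypotheses survive the
  passage to the sublevel set of a single function by the two-function case, so no separation in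
  higher dimensions is needed.\<close>

lemma common_sublevel:
  assumes "compact_space T" "F \<noteq> {}"
    and cont: "\<And>f. f \<in> F \<Longrightarrow> continuous_map T euclideanreal f"
    and mix: "\<And>p q t. \<lbrakk>p \<in> topspace T; q \<in> topspace T; 0 \<le> t; t \<le> 1\<rbrakk>
      \<Longrightarrow> \<exists>r\<in>topspace T. \<forall>f\<in>F. f r = (1 - t) * f p + t * f q"
    and conv: "\<And>f g t. \<lbrakk>f \<in> F; g \<in> F; 0 \<le> t; t \<le> 1\<rbrakk>
      \<Longrightarrow> \<exists>h\<in>F. \<forall>p\<in>topspace T. h p = (1 - t) * f p + t * g p"
    and low: "\<And>f. f \<in> F \<Longrightarrow> \<exists>p\<in>topspace T. f p \<le> c"
  shows "\<exists>p\<in>topspace T. \<forall>f\<in>F. f p \<le> c"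
proof -
  have closed: "closedin T {p \<in> topspace T. f p \<le> c}" if "f \<in> F" for f
    using closedin_continuous_map_preimage[OF cont[OF that], of "{..c}"] by simp
  \<comment> \<open>The extra function \<open>f\<close> stays quantified inside the induction: the
    hypothesis for \<open>G\<close> is applied to \<open>f\<close> itself, to \<open>g\<close>, and
    to convex combinations of the two.\<close>
  have fin: "\<forall>f\<in>F. \<exists>p\<in>topspace T. (\<forall>g\<in>G. g p \<le> c) \<and> f p \<le> c" if "finite G" "G \<subseteq> F" for G
    using that
  proof (induction G)
    case empty then show ?case using low by auto
  next
    case (insert g G)
    define S where "S = {p \<in> topspace T. \<forall>g\<in>G. g p \<le> c}"
    show ?case
    proof
      fix f assume f: "f \<in> F"
      have "S = \<Inter> (insert (topspace T) ((\<lambda>g. {p \<in> topspace T. g p \<le> c}) ` G))"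
        by (auto simp: S_def)
      also have "closedin T \<dots>"
        using closed insert.prems by (intro closedin_Inter) auto
      finally have "compactin T S" using assms(1) closedin_compact_space by blast
      moreover have "S \<noteq> {}" using insert f by (auto simp: S_def)
      moreover have "\<exists>r\<in>S. f r = (1 - t) * f p + t * f q \<and> g r = (1 - t) * g p + t * g q"
        if pqt: "p \<in> S" "q \<in> S" "0 \<le> t" "t \<le> 1" for p q t
      proof -
        obtain r where r: "r \<in> topspace T" "\<forall>f\<in>F. f r = (1 - t) * f p + t * f q"
          using mix[of p q t] pqt by (auto simp: S_def)
        have "h r \<le> c" if h: "h \<in> G" for h
        proof -
          have "h p \<le> c" "h q \<le> c" using \<open>p \<in> S\<close> \<open>q \<in> S\<close> h by (auto simp: S_def)
          moreover have "h r = (1 - t) * h p + t * h q" using r h insert.prems by auto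
          ultimately show ?thesis
            using convex_bound_le[of "h p" c "h q" "1 - t" t] \<open>0 \<le> t\<close> \<open>t \<le> 1\<close> by simp
        qed
        then show ?thesis using r f insert.prems by (auto simp: S_def)
      qed
      moreover have "\<exists>p\<in>S. (1 - t) * f p + t * g p \<le> c" if t: "0 \<le> t" "t \<le> 1" for t
      proof -
        obtain h where h: "h \<in> F" "\<forall>p\<in>topspace T. h p = (1 - t) * f p + t * g p"
          using conv[of f g t] f insert.prems t by auto
        then obtain p where "p \<in> topspace T" "\<forall>g\<in>G. g p \<le> c" "h p \<le> c" using insert by blast
        then show ?thesis using h(2) by (auto simp: S_def)
      qed
      ultimately have "\<exists>p\<in>S. f p \<le> c \<and> g p \<le> c"
        using f insert.prems by (intro common_sublevel_two) (auto intro: cont)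
      then show "\<exists>p\<in>topspace T. (\<forall>h\<in>insert g G. h p \<le> c) \<and> f p \<le> c"
        by (auto simp: S_def)
    qed
  qed
  define \<U> where "\<U> = (\<lambda>f. {p \<in> topspace T. f p \<le> c}) ` F"
  have "\<Inter>\<U> \<noteq> {}"
  proof (rule compact_space_fip[THEN iffD1, rule_format, OF assms(1)], intro conjI ballI allI impI)
    show "closedin T C" if "C \<in> \<U>" for C using that closed by (auto simp: \<U>_def)
    fix \<F> assume "finite \<F> \<and> \<F> \<subseteq> \<U>"
    then obtain G where "finite G" "G \<subseteq> F" "\<F> = (\<lambda>f. {p \<in> topspace T. f p \<le> c}) ` G"
      unfolding \<U>_def by (meson finite_subset_image)
    moreover obtain p where "p \<in> topspace T" "\<forall>g\<in>G. g p \<le> c"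
      using fin[of G] calculation assms(2) by blast
    ultimately have "p \<in> \<Inter>\<F>" by auto
    then show "\<Inter>\<F> \<noteq> {}" by blast
  qed
  then show ?thesis using assms(2) by (auto simp: \<U>_def)
qed

section \<open>Expectations and densities\<close>

text \<open>This is the representative that \<open>weakly_compact\<close> puts into the weak
  topology, so the compact sets are images under \<open>dens P\<close>.\<close>

definition dens :: "'a measure \<Rightarrow> 'a measure \<Rightarrow> 'a \<Rightarrow> real" where
  "dens P Q x = enn2real (RN_deriv P Q x)"

lemma expec_integrable:
  assumes "integrable Q X"
  shows "expec Q X = ereal (\<integral>x. X x \<partial>Q)"
proof -
  have p: "integrable Q (\<lambda>x. max 0 (X x))" and m: "integrable Q (\<lambda>x. max 0 (- X x))"
    using assms by auto
  have "(\<integral>x. X x \<partial>Q) = (\<integral>x. max 0 (X x) - max 0 (- X x) \<partial>Q)"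
    by (intro Bochner_Integration.integral_cong) auto
  also have "\<dots> = (\<integral>x. max 0 (X x) \<partial>Q) - (\<integral>x. max 0 (- X x) \<partial>Q)"
    using p m by simp
  finally show ?thesis
    using nn_integral_eq_integral[OF p] nn_integral_eq_integral[OF m] by (simp add: expec_def)
qed

lemma integrable_iff_parts:
  fixes X :: "'a \<Rightarrow> real"
  assumes "X \<in> borel_measurable Q"
  shows "integrable Q X \<longleftrightarrow>
    (\<integral>\<^sup>+x. ennreal (max 0 (X x)) \<partial>Q) \<noteq> \<infinity> \<and> (\<integral>\<^sup>+x. ennreal (max 0 (- X x)) \<partial>Q) \<noteq> \<infinity>"
proof -
  have "ennreal (max 0 a) = ennreal a" for a by (simp add: max_def ennreal_neg)
  then show ?thesis using assms by (auto simp: real_integrable_def)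
qed

lemma expec_not_integrable:
  assumes "X \<in> borel_measurable Q" "\<not> integrable Q X"
  shows "expec Q X = (if (\<integral>\<^sup>+x. ennreal (max 0 (- X x)) \<partial>Q) = \<infinity> then - \<infinity> else \<infinity>)"
proof (cases "(\<integral>\<^sup>+x. ennreal (max 0 (- X x)) \<partial>Q) = \<infinity>")
  case False
  then have "(\<integral>\<^sup>+x. ennreal (max 0 (X x)) \<partial>Q) = \<infinity>" using assms by (simp add: integrable_iff_parts)
  moreover obtain r where "(\<integral>\<^sup>+x. ennreal (max 0 (- X x)) \<partial>Q) = ennreal r" "0 \<le> r"
    using False by (cases "\<integral>\<^sup>+x. ennreal (max 0 (- X x)) \<partial>Q") auto
  ultimately show ?thesis by (simp add: expec_def)
qed (simp add: expec_def)

lemma integrable_of_expec_finite: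
  assumes "X \<in> borel_measurable Q" "- \<infinity> < expec Q X" "expec Q X < \<infinity>"
  shows "integrable Q X"
proof (rule ccontr)
  assume "\<not> integrable Q X"
  from expec_not_integrable[OF assms(1) this] assms(2,3) show False by (auto split: if_split_asm)
qed

text \<open>Only one summand is integrable, because members of the cones need not be. Adding an
  integrable \<open>Z\<close> changes the negative part by at most the absolute value of
  \<open>Z\<close>, so a non-integrable \<open>X\<close> keeps its infinite value;
  \<open>mono\<close> is used with \<open>Z\<close> and with \<open>-Z\<close>.\<close>

lemma expec_add:
  assumes Z: "integrable Q Z" and X: "X \<in> borel_measurable Q"
  shows "expec Q (\<lambda>x. Z x + X x) = ereal (\<integral>x. Z x \<partial>Q) + expec Q X"
proof (cases "integrable Q X")
  case True
  then show ?thesis using Z by (simp add: expec_integrable)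
next
  case False
  have ni: "\<not> integrable Q (\<lambda>x. Z x + X x)"
    using Bochner_Integration.integrable_diff[OF _ Z, of "\<lambda>x. Z x + X x"] False by auto
  have [measurable]: "Z \<in> borel_measurable Q" using Z by auto
  note X [measurable]
  have mono: "(\<integral>\<^sup>+x. ennreal (max 0 (- b x)) \<partial>Q) = \<infinity>"
    if "(\<integral>\<^sup>+x. ennreal (max 0 (- a x)) \<partial>Q) = \<infinity>"
      and [measurable]: "b \<in> borel_measurable Q" and c: "integrable Q c"
      and abc: "\<And>x. b x \<le> a x + c x" for a b c
  proof -
    have [measurable]: "c \<in> borel_measurable Q" using c by auto
    have "(\<integral>\<^sup>+x. ennreal (max 0 (- a x)) \<partial>Q) \<le> (\<integral>\<^sup>+x. ennreal (max 0 (- b x)) + ennreal (norm (c x)) \<partial>Q)"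
    proof (intro nn_integral_mono)
      fix x
      have "max 0 (- a x) \<le> max 0 (- b x) + norm (c x)" using abc[of x] by auto
      then show "ennreal (max 0 (- a x)) \<le> ennreal (max 0 (- b x)) + ennreal (norm (c x))"
        by (metis ennreal_leI ennreal_plus max.cobounded1 norm_ge_zero)
    qed
    also have "\<dots> = (\<integral>\<^sup>+x. ennreal (max 0 (- b x)) \<partial>Q) + (\<integral>\<^sup>+x. ennreal (norm (c x)) \<partial>Q)"
      by (intro nn_integral_add) auto
    finally show ?thesis
      using that(1) c by (auto simp: integrable_iff_bounded less_top top_unique)
  qed
  have "(\<integral>\<^sup>+x. ennreal (max 0 (- (Z x + X x))) \<partial>Q) = \<infinity> \<longleftrightarrow> (\<integral>\<^sup>+x. ennreal (max 0 (- X x)) \<partial>Q) = \<infinity>"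
    using mono[of X "\<lambda>x. Z x + X x" Z] mono[of "\<lambda>x. Z x + X x" X "\<lambda>x. - Z x"] Z by auto
  then show ?thesis
    using expec_not_integrable[OF X False] expec_not_integrable[OF _ ni] by auto
qed

lemma expec_cong_AE:
  assumes "AE x in Q. X x = Y x"
  shows "expec Q X = expec Q Y"
proof -
  have "(\<integral>\<^sup>+x. ennreal (max 0 (X x)) \<partial>Q) = (\<integral>\<^sup>+x. ennreal (max 0 (Y x)) \<partial>Q)"
    "(\<integral>\<^sup>+x. ennreal (max 0 (- X x)) \<partial>Q) = (\<integral>\<^sup>+x. ennreal (max 0 (- Y x)) \<partial>Q)"
    by (intro nn_integral_cong_AE; use assms in eventually_elim; simp)+
  then show ?thesis by (simp add: expec_def)
qed

lemma ac_probsD: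
  assumes "Q \<in> ac_probs P"
  shows "prob_space Q" "sets Q = sets P" "space Q = space P" "absolutely_continuous P Q"
  using assms sets_eq_imp_space_eq by (auto simp: ac_probs_def)

lemma borel_measurable_ac_probs:
  assumes "Q \<in> ac_probs P" "X \<in> borel_measurable P"
  shows "X \<in> borel_measurable Q"
  using assms ac_probsD(2) measurable_cong_sets by blast

lemma AE_ac_probs:
  assumes "Q \<in> ac_probs P" "AE x in P. R x"
  shows "AE x in Q. R x"
  using absolutely_continuous_AE[of Q P R] ac_probsD[OF assms(1)] assms(2) by auto

context prob_space begin

text \<open>\<open>enn2real\<close> sends an infinite derivative to 0; the derivative of a
  probability measure is finite almost everywhere, so no mass is lost.\<close>

lemma density_dens:
  assumes "Q \<in> ac_probs M"
  shows "dens M Q \<in> borel_measurable M" "\<And>x. 0 \<le> dens M Q x"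
    "density M (\<lambda>x. ennreal (dens M Q x)) = Q"
proof -
  interpret Q: prob_space Q using ac_probsD(1)[OF assms] .
  note ac = ac_probsD(4,2)[OF assms]
  show "dens M Q \<in> borel_measurable M" "\<And>x. 0 \<le> dens M Q x"
    by (auto simp: dens_def[abs_def])
  have "AE x in M. ennreal (dens M Q x) = RN_deriv M Q x"
    using RN_deriv_finite[OF Q.sigma_finite_measure_axioms ac]
    by eventually_elim (auto simp: dens_def less_top)
  then have "density M (\<lambda>x. ennreal (dens M Q x)) = density M (RN_deriv M Q)"
    by (intro density_cong) (auto simp: dens_def)
  then show "density M (\<lambda>x. ennreal (dens M Q x)) = Q" using density_RN_deriv[OF ac] by simp
qed

lemma integral_dens:
  fixes X :: "'a \<Rightarrow> real"
  assumes "Q \<in> ac_probs M" "X \<in> borel_measurable M"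
  shows "integrable Q X \<longleftrightarrow> integrable M (\<lambda>x. dens M Q x * X x)"
    and "(\<integral>x. X x \<partial>Q) = (\<integral>x. dens M Q x * X x \<partial>M)"
proof -
  interpret Q: prob_space Q using ac_probsD(1)[OF assms(1)] .
  note ac = ac_probsD(4,2)[OF assms(1)]
  show "integrable Q X \<longleftrightarrow> integrable M (\<lambda>x. dens M Q x * X x)"
    unfolding dens_def by (rule RN_deriv_integrable[OF Q.sigma_finite_measure_axioms ac assms(2)])
  show "(\<integral>x. X x \<partial>Q) = (\<integral>x. dens M Q x * X x \<partial>M)"
    unfolding dens_def by (rule RN_deriv_integral[OF Q.sigma_finite_measure_axioms ac assms(2)])
qed

text \<open>The mixture is obtained by mixing densities. The identity is stated for nonnegative
  extended integrals, so that infinite positive or negative parts remain visible.\<close>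

lemma ac_probs_mixture:
  assumes Q: "Q \<in> ac_probs M" and Q': "Q' \<in> ac_probs M" and t: "0 < t" "t < 1"
  obtains R where "R \<in> ac_probs M"
    "\<And>X. X \<in> borel_measurable M \<Longrightarrow>
      (\<integral>\<^sup>+x. X x \<partial>R) = ennreal (1 - t) * (\<integral>\<^sup>+x. X x \<partial>Q) + ennreal t * (\<integral>\<^sup>+x. X x \<partial>Q')"
proof -
  note density_dens(1)[OF Q, measurable] density_dens(1)[OF Q', measurable]
  define f where "f x = (1 - t) * dens M Q x + t * dens M Q' x" for x
  have [measurable]: "f \<in> borel_measurable M" unfolding f_def by measurable
  have fe: "ennreal (f x) = ennreal (1 - t) * ennreal (dens M Q x) + ennreal t * ennreal (dens M Q' x)" for x
    using t density_dens(2)[OF Q, of x] density_dens(2)[OF Q', of x] by (simp add: f_def ennreal_mult ennreal_plus)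
  define R where "R = density M (\<lambda>x. ennreal (f x))"
  have int: "(\<integral>\<^sup>+x. X x \<partial>R) = ennreal (1 - t) * (\<integral>\<^sup>+x. X x \<partial>Q) + ennreal t * (\<integral>\<^sup>+x. X x \<partial>Q')"
    if [measurable]: "X \<in> borel_measurable M" for X
  proof -
    have "(\<integral>\<^sup>+x. X x \<partial>R) = (\<integral>\<^sup>+x. ennreal (1 - t) * (ennreal (dens M Q x) * X x) +
        ennreal t * (ennreal (dens M Q' x) * X x) \<partial>M)"
      unfolding R_def by (simp add: nn_integral_density fe distrib_right mult.assoc)
    also have "\<dots> = ennreal (1 - t) * (\<integral>\<^sup>+x. ennreal (dens M Q x) * X x \<partial>M) +
        ennreal t * (\<integral>\<^sup>+x. ennreal (dens M Q' x) * X x \<partial>M)"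
      by (simp add: nn_integral_add nn_integral_cmult)
    also have "(\<integral>\<^sup>+x. ennreal (dens M Q x) * X x \<partial>M) = (\<integral>\<^sup>+x. X x \<partial>Q)"
      by (subst (2) density_dens(3)[OF Q, symmetric]) (simp add: nn_integral_density)
    also have "(\<integral>\<^sup>+x. ennreal (dens M Q' x) * X x \<partial>M) = (\<integral>\<^sup>+x. X x \<partial>Q')"
      by (subst (2) density_dens(3)[OF Q', symmetric]) (simp add: nn_integral_density)
    finally show ?thesis .
  qed
  have "emeasure R (space R) = (\<integral>\<^sup>+x. 1 \<partial>R)" by simp
  also have "\<dots> = ennreal (1 - t) + ennreal t"
    using int[of "\<lambda>_. 1"] prob_space.emeasure_space_1[OF ac_probsD(1)[OF Q]]
      prob_space.emeasure_space_1[OF ac_probsD(1)[OF Q']] by simp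
  also have "\<dots> = 1" using t by (simp flip: ennreal_plus)
  finally have "prob_space R" by (rule prob_spaceI)
  moreover have "absolutely_continuous M R"
    unfolding R_def by (intro absolutely_continuousI_density) auto
  ultimately have "R \<in> ac_probs M" by (simp add: ac_probs_def R_def)
  then show thesis using int that by blast
qed

end

text \<open>With strictly positive weights a mixed nonnegative integral is infinite exactly when one
  of the two integrals is. Applied to positive and negative parts this settles integrability, and
  subtraction gives the formula.\<close>

lemma mixture_integral:
  fixes X :: "'a \<Rightarrow> real"
  assumes t: "0 < t" "t < 1" and R: "\<And>X. X \<in> borel_measurable P \<Longrightarrow>
      (\<integral>\<^sup>+x. X x \<partial>R) = ennreal (1 - t) * (\<integral>\<^sup>+x. X x \<partial>Q) + ennreal t * (\<integral>\<^sup>+x. X x \<partial>Q')"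
    and ac: "Q \<in> ac_probs P" "Q' \<in> ac_probs P" "R \<in> ac_probs P" and X: "X \<in> borel_measurable P"
  shows "integrable R X \<longleftrightarrow> integrable Q X \<and> integrable Q' X" (is ?int)
    and "integrable R X \<Longrightarrow> (\<integral>x. X x \<partial>R) = (1 - t) * (\<integral>x. X x \<partial>Q) + t * (\<integral>x. X x \<partial>Q')"
proof -
  note X[measurable]
  have fin: "ennreal (1 - t) * a + ennreal t * b = \<infinity> \<longleftrightarrow> a = \<infinity> \<or> b = \<infinity>" for a b
    using t by (auto simp: ennreal_mult_eq_top_iff)
  have m: "X \<in> borel_measurable S" if "S \<in> ac_probs P" for S
    using that X by (rule borel_measurable_ac_probs)
  have p: "(\<lambda>x. ennreal (max 0 (X x))) \<in> borel_measurable P"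
    "(\<lambda>x. ennreal (max 0 (- X x))) \<in> borel_measurable P" by measurable
  show ?int
    unfolding integrable_iff_parts[OF m[OF ac(1)]] integrable_iff_parts[OF m[OF ac(2)]]
      integrable_iff_parts[OF m[OF ac(3)]] R[OF p(1)] R[OF p(2)] fin by blast
  assume i: "integrable R X"
  then have i': "integrable Q X" "integrable Q' X" using \<open>?int\<close> by auto
  have pos: "(\<integral>x. Z x \<partial>R) = (1 - t) * (\<integral>x. Z x \<partial>Q) + t * (\<integral>x. Z x \<partial>Q')"
    if Z: "\<And>x. 0 \<le> Z x" "Z \<in> borel_measurable P" "integrable R Z" "integrable Q Z" "integrable Q' Z"
    for Z :: "'a \<Rightarrow> real"
  proof -
    have "ennreal (\<integral>x. Z x \<partial>R) = ennreal (1 - t) * ennreal (\<integral>x. Z x \<partial>Q) + ennreal t * ennreal (\<integral>x. Z x \<partial>Q')"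
      using R[of Z] Z by (simp add: nn_integral_eq_integral)
    also have "\<dots> = ennreal ((1 - t) * (\<integral>x. Z x \<partial>Q) + t * (\<integral>x. Z x \<partial>Q'))"
      using t Z by (simp add: ennreal_mult ennreal_plus)
    finally show ?thesis
      by (rule ennreal_inj[THEN iffD1, rotated 2]) (use Z t in auto)
  qed
  have split: "(\<integral>x. X x \<partial>S) = (\<integral>x. max 0 (X x) \<partial>S) - (\<integral>x. max 0 (- X x) \<partial>S)" if "integrable S X" for S
  proof -
    have "(\<integral>x. X x \<partial>S) = (\<integral>x. max 0 (X x) - max 0 (- X x) \<partial>S)"
      by (intro Bochner_Integration.integral_cong) auto
    then show ?thesis using that by simp
  qed
  show "(\<integral>x. X x \<partial>R) = (1 - t) * (\<integral>x. X x \<partial>Q) + t * (\<integral>x. X x \<partial>Q')"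
    unfolding split[OF i] split[OF i'(1)] split[OF i'(2)]
    using i i' pos[of "\<lambda>x. max 0 (X x)"] pos[of "\<lambda>x. max 0 (- X x)"] by (simp add: algebra_simps)
qed

section \<open>Uniform integrability and weak continuity\<close>

text \<open>In this form, closure under linear combinations and weak continuity of expectations need no
  manipulation of tails.\<close>

lemma L1s_iff_approx:
  assumes D: "D \<subseteq> ac_probs P"
  shows "Z \<in> L1s P D \<longleftrightarrow> Z \<in> borel_measurable P \<and>
    (\<forall>e>0. \<exists>B c. B \<in> borel_measurable P \<and> (\<forall>x. \<bar>B x\<bar> \<le> c) \<and>
      (\<forall>Q\<in>D. (\<integral>\<^sup>+x. ennreal \<bar>Z x - B x\<bar> \<partial>Q) \<le> ennreal e))"
    (is "?l \<longleftrightarrow> _ \<and> (\<forall>e>0. ?approx e)")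
proof (intro iffI conjI allI impI)
  assume l: ?l
  then show [measurable]: "Z \<in> borel_measurable P" by (simp add: L1s_def L0_def)
  fix e :: real assume "0 < e"
  have "(\<lambda>n::nat. SUP Q\<in>D. \<integral>\<^sup>+x. ennreal (\<bar>Z x\<bar> * indicator {x. \<bar>Z x\<bar> > real n} x) \<partial>Q) \<longlonglongrightarrow> 0"
    using l by (simp add: L1s_def)
  from order_tendstoD(2)[OF this, of "ennreal e"] \<open>0 < e\<close>
  obtain n :: nat where n: "(SUP Q\<in>D. \<integral>\<^sup>+x. ennreal (\<bar>Z x\<bar> * indicator {x. \<bar>Z x\<bar> > real n} x) \<partial>Q) < ennreal e"
    by (auto simp: eventually_sequentially)
  define B where "B x = (if \<bar>Z x\<bar> \<le> real n then Z x else 0)" for x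
  have "\<bar>Z x\<bar> * indicator {x. \<bar>Z x\<bar> > real n} x = \<bar>Z x - B x\<bar>" for x
    by (simp add: B_def indicator_def)
  then have "(\<integral>\<^sup>+x. ennreal \<bar>Z x - B x\<bar> \<partial>Q) \<le> ennreal e" if "Q \<in> D" for Q
    using SUP_lessD[OF n that] by simp
  moreover have "B \<in> borel_measurable P" unfolding B_def by measurable
  moreover have "\<bar>B x\<bar> \<le> real n" for x by (simp add: B_def)
  ultimately show "?approx e" by blast
next
  assume r: "Z \<in> borel_measurable P \<and> (\<forall>e>0. ?approx e)"
  then have [measurable]: "Z \<in> borel_measurable P" by blast
  have "(\<lambda>n::nat. SUP Q\<in>D. \<integral>\<^sup>+x. ennreal (\<bar>Z x\<bar> * indicator {x. \<bar>Z x\<bar> > real n} x) \<partial>Q) \<longlonglongrightarrow> 0"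
  proof (rule order_tendstoI)
    fix a :: ennreal assume "0 < a"
    obtain e where e: "0 < e" "ennreal (2 * e) < a"
    proof (cases a)
      case (real r)
      then show thesis using \<open>0 < a\<close> by (intro that[of "r / 4"]) (auto simp: ennreal_less_iff)
    next
      case top
      then show thesis by (intro that[of 1]) auto
    qed
    obtain B c where B[measurable]: "B \<in> borel_measurable P" and Bc: "\<And>x. \<bar>B x\<bar> \<le> c"
      and BQ: "\<And>Q. Q \<in> D \<Longrightarrow> (\<integral>\<^sup>+x. ennreal \<bar>Z x - B x\<bar> \<partial>Q) \<le> ennreal e"
      using r e(1) by blast
    obtain m :: nat where m: "2 * c \<le> real m" using real_arch_simple by blast
    have "(SUP Q\<in>D. \<integral>\<^sup>+x. ennreal (\<bar>Z x\<bar> * indicator {x. \<bar>Z x\<bar> > real n} x) \<partial>Q) < a" if "m \<le> n" for n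
    proof -
      have "(\<integral>\<^sup>+x. ennreal (\<bar>Z x\<bar> * indicator {x. \<bar>Z x\<bar> > real n} x) \<partial>Q) \<le> ennreal (2 * e)" if "Q \<in> D" for Q
      proof -
        have Q: "Q \<in> ac_probs P" using that D by blast
        have [measurable]: "Z \<in> borel_measurable Q" "B \<in> borel_measurable Q"
          by (auto intro: borel_measurable_ac_probs[OF Q])
        \<comment> \<open>On the tail \<open>\<bar>Z x\<bar> > 2 * c\<close>, so the bounded
          approximation accounts for less than half of \<open>Z x\<close> and the error for at least
          half.\<close>
        have "\<bar>Z x\<bar> * indicator {x. \<bar>Z x\<bar> > real n} x \<le> 2 * \<bar>Z x - B x\<bar>" for x
        proof -
          have "2 * c \<le> real n" using m \<open>m \<le> n\<close> by linarith
          then show ?thesis using Bc[of x] abs_triangle_ineq2[of "Z x" "B x"] by (simp add: indicator_def)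
        qed
        then have "(\<integral>\<^sup>+x. ennreal (\<bar>Z x\<bar> * indicator {x. \<bar>Z x\<bar> > real n} x) \<partial>Q)
            \<le> (\<integral>\<^sup>+x. ennreal (2 * \<bar>Z x - B x\<bar>) \<partial>Q)"
          by (intro nn_integral_mono ennreal_leI) auto
        also have "\<dots> = 2 * (\<integral>\<^sup>+x. ennreal \<bar>Z x - B x\<bar> \<partial>Q)"
          by (simp add: ennreal_mult nn_integral_cmult)
        also have "\<dots> \<le> 2 * ennreal e" using BQ[OF that] by (intro mult_left_mono) auto
        finally show ?thesis using e by (simp add: ennreal_mult)
      qed
      then have "(SUP Q\<in>D. \<integral>\<^sup>+x. ennreal (\<bar>Z x\<bar> * indicator {x. \<bar>Z x\<bar> > real n} x) \<partial>Q) \<le> ennreal (2 * e)"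
        by (intro SUP_least)
      then show ?thesis using e(2) by (rule order_le_less_trans)
    qed
    then show "\<forall>\<^sub>F n in sequentially.
        (SUP Q\<in>D. \<integral>\<^sup>+x. ennreal (\<bar>Z x\<bar> * indicator {x. \<bar>Z x\<bar> > real n} x) \<partial>Q) < a"
      by (auto simp: eventually_sequentially)
  qed simp
  then show ?l by (simp add: L1s_def L0_def)
qed

lemma L1s_measurable: "Z \<in> L1s P D \<Longrightarrow> Z \<in> borel_measurable P"
  by (simp add: L1s_def L0_def)

lemma L1s_bounded:
  assumes "D \<subseteq> ac_probs P" "B \<in> borel_measurable P" "\<And>x. \<bar>B x\<bar> \<le> c"
  shows "B \<in> L1s P D"
  using assms by (auto simp: L1s_iff_approx intro!: exI[of _ B] exI[of _ c])

lemma L1s_integrable: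
  assumes "D \<subseteq> ac_probs P" "Z \<in> L1s P D" "Q \<in> D"
  shows "integrable Q Z"
proof -
  obtain B c where B: "B \<in> borel_measurable P" "\<And>x. \<bar>B x\<bar> \<le> c"
    "(\<integral>\<^sup>+x. ennreal \<bar>Z x - B x\<bar> \<partial>Q) \<le> ennreal 1"
    using assms(2,3) zero_less_one unfolding L1s_iff_approx[OF assms(1)] by blast
  have Q: "Q \<in> ac_probs P" using assms by auto
  interpret Q: prob_space Q using ac_probsD(1)[OF Q] .
  have [measurable]: "Z \<in> borel_measurable Q" "B \<in> borel_measurable Q"
    using B assms by (auto intro: borel_measurable_ac_probs[OF Q] L1s_measurable)
  have "(\<integral>\<^sup>+x. ennreal \<bar>Z x - B x\<bar> \<partial>Q) < \<infinity>"
    using B(3) by (rule order_le_less_trans) simp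
  then have ZB: "integrable Q (\<lambda>x. Z x - B x)" by (simp add: integrable_iff_bounded)
  have "integrable Q B" using B by (intro Q.integrable_const_bound[of _ c]) auto
  from Bochner_Integration.integrable_add[OF ZB this] show ?thesis by simp
qed

lemma L1s_lincomb:
  assumes D: "D \<subseteq> ac_probs P" and X: "X \<in> L1s P D" and Y: "Y \<in> L1s P D"
  shows "(\<lambda>x. s * X x + t * Y x) \<in> L1s P D"
  unfolding L1s_iff_approx[OF D]
proof (intro conjI allI impI)
  have mX[measurable]: "X \<in> borel_measurable P" and mY[measurable]: "Y \<in> borel_measurable P"
    using X Y by (auto intro: L1s_measurable)
  show "(\<lambda>x. s * X x + t * Y x) \<in> borel_measurable P" by measurable
  fix e :: real assume e: "0 < e"
  \<comment> \<open>The summand 1 keeps \<open>k\<close> positive when both coefficients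
    vanish.\<close>
  define k where "k = \<bar>s\<bar> + \<bar>t\<bar> + 1"
  have k: "0 < k" by (simp add: k_def)
  obtain A a where A: "A \<in> borel_measurable P" "\<And>x. \<bar>A x\<bar> \<le> a"
    "\<And>Q. Q \<in> D \<Longrightarrow> (\<integral>\<^sup>+x. ennreal \<bar>X x - A x\<bar> \<partial>Q) \<le> ennreal (e / k)"
    using X e k unfolding L1s_iff_approx[OF D] by (meson divide_pos_pos)
  obtain B b where B: "B \<in> borel_measurable P" "\<And>x. \<bar>B x\<bar> \<le> b"
    "\<And>Q. Q \<in> D \<Longrightarrow> (\<integral>\<^sup>+x. ennreal \<bar>Y x - B x\<bar> \<partial>Q) \<le> ennreal (e / k)"
    using Y e k unfolding L1s_iff_approx[OF D] by (meson divide_pos_pos)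
  show "\<exists>B' c. B' \<in> borel_measurable P \<and> (\<forall>x. \<bar>B' x\<bar> \<le> c) \<and>
    (\<forall>Q\<in>D. (\<integral>\<^sup>+x. ennreal \<bar>s * X x + t * Y x - B' x\<bar> \<partial>Q) \<le> ennreal e)"
  proof (intro exI[of _ "\<lambda>x. s * A x + t * B x"] exI[of _ "\<bar>s\<bar> * a + \<bar>t\<bar> * b"] conjI allI ballI)
    show "(\<lambda>x. s * A x + t * B x) \<in> borel_measurable P" using A B by measurable
    show "\<bar>s * A x + t * B x\<bar> \<le> \<bar>s\<bar> * a + \<bar>t\<bar> * b" for x
      using mult_left_mono[OF A(2)[of x], of "\<bar>s\<bar>"] mult_left_mono[OF B(2)[of x], of "\<bar>t\<bar>"]
        abs_triangle_ineq[of "s * A x" "t * B x"] by (simp add: abs_mult)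
    fix Q assume "Q \<in> D"
    then have Q: "Q \<in> ac_probs P" using D by auto
    have [measurable]: "X \<in> borel_measurable Q" "Y \<in> borel_measurable Q" "A \<in> borel_measurable Q"
      "B \<in> borel_measurable Q"
      using A B mX mY by (auto intro: borel_measurable_ac_probs[OF Q])
    have "\<bar>s * X x + t * Y x - (s * A x + t * B x)\<bar> \<le> \<bar>s\<bar> * \<bar>X x - A x\<bar> + \<bar>t\<bar> * \<bar>Y x - B x\<bar>" for x
    proof -
      have "s * X x + t * Y x - (s * A x + t * B x) = s * (X x - A x) + t * (Y x - B x)"
        by (simp add: algebra_simps)
      then show ?thesis
        using abs_triangle_ineq[of "s * (X x - A x)" "t * (Y x - B x)"] by (simp only: abs_mult)
    qed
    then have "(\<integral>\<^sup>+x. ennreal \<bar>s * X x + t * Y x - (s * A x + t * B x)\<bar> \<partial>Q) \<le>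
      (\<integral>\<^sup>+x. ennreal \<bar>s\<bar> * ennreal \<bar>X x - A x\<bar> + ennreal \<bar>t\<bar> * ennreal \<bar>Y x - B x\<bar> \<partial>Q)"
      by (intro nn_integral_mono) (simp add: ennreal_leI flip: ennreal_mult ennreal_plus)
    also have "\<dots> = ennreal \<bar>s\<bar> * (\<integral>\<^sup>+x. ennreal \<bar>X x - A x\<bar> \<partial>Q) + ennreal \<bar>t\<bar> * (\<integral>\<^sup>+x. ennreal \<bar>Y x - B x\<bar> \<partial>Q)"
      by (simp add: nn_integral_add nn_integral_cmult)
    also have "\<dots> \<le> ennreal \<bar>s\<bar> * ennreal (e / k) + ennreal \<bar>t\<bar> * ennreal (e / k)"
      using A(3) B(3) \<open>Q \<in> D\<close> by (intro add_mono mult_left_mono) auto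
    also have "\<dots> = ennreal ((\<bar>s\<bar> + \<bar>t\<bar>) * (e / k))"
      using e k by (simp add: distrib_right add_divide_distrib flip: ennreal_mult ennreal_plus)
    also have "(\<bar>s\<bar> + \<bar>t\<bar>) * (e / k) \<le> k * (e / k)"
      using e k by (intro mult_right_mono) (auto simp: k_def)
    also have "k * (e / k) = e" using k by simp
    finally show "(\<integral>\<^sup>+x. ennreal \<bar>s * X x + t * Y x - (s * A x + t * B x)\<bar> \<partial>Q) \<le> ennreal e"
      by (simp add: ennreal_leI)
  qed
qed

lemma L1s_add:
  assumes "D \<subseteq> ac_probs P" "X \<in> L1s P D" "Y \<in> L1s P D"
  shows "(\<lambda>x. X x + Y x) \<in> L1s P D"
  using L1s_lincomb[OF assms, of 1 1] by simp

section \<open>The weak topology on densities and attainment of infima\<close>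

lemma topspace_weak_L1: "topspace (weak_L1 P) = {f. integrable P f}"
proof -
  have "{f. integrable P f} = {f. integrable P f \<and> (\<integral>x. f x * (\<lambda>_. 0) x \<partial>P) \<in> UNIV}" by simp
  moreover have "(\<lambda>_. 0) \<in> Linf P" by (auto simp: Linf_def L0_def)
  ultimately show ?thesis
    unfolding weak_L1_def topology_generated_by_topspace by blast
qed

lemma continuous_map_weak_L1:
  assumes "g \<in> Linf P"
  shows "continuous_map (weak_L1 P) euclideanreal (\<lambda>f. \<integral>x. f x * g x \<partial>P)"
proof -
  have "openin (weak_L1 P) {f. integrable P f \<and> (\<integral>x. f x * g x \<partial>P) \<in> U}" if "open U" for U
    unfolding weak_L1_def by (rule topology_generated_by_Basis) (use that assms in blast)
  then show ?thesis by (simp add: continuous_map_def topspace_weak_L1)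
qed

context prob_space begin

lemma continuous_map_integral_dens:
  assumes D: "D \<subseteq> ac_probs M" and Z: "Z \<in> L1s M D"
  shows "continuous_map (subtopology (weak_L1 M) (dens M ` D)) euclideanreal (\<lambda>f. \<integral>x. f x * Z x \<partial>M)"
    (is "continuous_map ?T _ _")
proof -
  have "continuous_map ?T Met_TC.mtopology (\<lambda>f. \<integral>x. f x * Z x \<partial>M)"
    unfolding Met_TC.continuous_map_to_metric mball_eq_ball
  proof (intro ballI allI impI)
    fix f and e :: real assume f: "f \<in> topspace ?T" and e: "0 < e"
    obtain B c where B[measurable]: "B \<in> borel_measurable M" and c: "\<And>x. \<bar>B x\<bar> \<le> c"
      and ZB: "\<And>Q. Q \<in> D \<Longrightarrow> (\<integral>\<^sup>+x. ennreal \<bar>Z x - B x\<bar> \<partial>Q) \<le> ennreal (e / 4)"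
      using Z e unfolding L1s_iff_approx[OF D] by (meson divide_pos_pos zero_less_numeral)
    have "B \<in> Linf M" using B c by (auto simp: Linf_def L0_def)
    then have "continuous_map ?T Met_TC.mtopology (\<lambda>f. \<integral>x. f x * B x \<partial>M)"
      unfolding mtopology_is_euclidean by (intro continuous_map_from_subtopology continuous_map_weak_L1)
    then obtain U where U: "openin ?T U" "f \<in> U"
      "\<And>g. g \<in> U \<Longrightarrow> (\<integral>x. g x * B x \<partial>M) \<in> ball (\<integral>x. f x * B x \<partial>M) (e / 4)"
      using f e unfolding Met_TC.continuous_map_to_metric mball_eq_ball
      by (meson divide_pos_pos zero_less_numeral)
    have near: "\<bar>(\<integral>x. g x * Z x \<partial>M) - (\<integral>x. g x * B x \<partial>M)\<bar> \<le> e / 4" if "g \<in> topspace ?T" for g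
    proof -
      from that obtain Q where Q: "Q \<in> D" "g = dens M Q" by auto
      then have ac: "Q \<in> ac_probs M" using D by auto
      have i: "integrable Q Z" "integrable Q B"
        using L1s_integrable[OF D _ Q(1)] Z L1s_bounded[OF D B c] by auto
      have eq: "(\<integral>x. g x * Y x \<partial>M) = (\<integral>x. Y x \<partial>Q)" if "Y \<in> borel_measurable M" for Y
        unfolding Q(2) integral_dens(2)[OF ac that] ..
      have "ennreal (\<integral>x. \<bar>Z x - B x\<bar> \<partial>Q) \<le> ennreal (e / 4)"
        using ZB[OF Q(1)] i by (subst nn_integral_eq_integral[symmetric]) auto
      then have "(\<integral>x. \<bar>Z x - B x\<bar> \<partial>Q) \<le> e / 4" using e by (simp add: ennreal_le_iff)
      moreover have "\<bar>\<integral>x. Z x - B x \<partial>Q\<bar> \<le> (\<integral>x. \<bar>Z x - B x\<bar> \<partial>Q)" by (rule integral_abs_bound)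
      moreover have "(\<integral>x. Z x - B x \<partial>Q) = (\<integral>x. Z x \<partial>Q) - (\<integral>x. B x \<partial>Q)" using i by simp
      ultimately show ?thesis using eq[OF B] eq[OF L1s_measurable[OF Z]] by linarith
    qed
    have "(\<integral>x. g x * Z x \<partial>M) \<in> ball (\<integral>x. f x * Z x \<partial>M) e" if "g \<in> U" for g
    proof -
      have "g \<in> topspace ?T" using that U(1) openin_subset by blast
      from near[OF this] near[OF f] U(3)[OF that, unfolded mem_ball dist_real_def] e
      show ?thesis unfolding mem_ball dist_real_def by linarith
    qed
    then show "\<exists>U. openin ?T U \<and> f \<in> U \<and>
        (\<forall>g\<in>U. (\<integral>x. g x * Z x \<partial>M) \<in> ball (\<integral>x. f x * Z x \<partial>M) e)"
      using U by blast
  qed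
  then show ?thesis by simp
qed

lemma dens_image: "(\<lambda>Q x. enn2real (RN_deriv M Q x)) ` D = dens M ` D"
  by (simp add: dens_def[abs_def])

lemma compact_space_dens:
  assumes "weakly_compact M D"
  shows "compact_space (subtopology (weak_L1 M) (dens M ` D))"
    and "topspace (subtopology (weak_L1 M) (dens M ` D)) = dens M ` D"
proof -
  have c: "compactin (weak_L1 M) (dens M ` D)"
    using assms by (simp add: weakly_compact_def dens_image)
  then show "compact_space (subtopology (weak_L1 M) (dens M ` D))" by (rule compact_space_subtopology)
  show "topspace (subtopology (weak_L1 M) (dens M ` D)) = dens M ` D"
    using compactin_subset_topspace[OF c] by (simp add: Int_absorb1)
qed

lemma integral_attains_inf:
  assumes "weakly_compact M D" and D: "D \<subseteq> ac_probs M" "D \<noteq> {}" and Z: "Z \<in> L1s M D"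
  shows "\<exists>Q\<in>D. \<forall>Q'\<in>D. (\<integral>x. Z x \<partial>Q) \<le> (\<integral>x. Z x \<partial>Q')"
proof -
  let ?T = "subtopology (weak_L1 M) (dens M ` D)"
  have "compactin euclideanreal ((\<lambda>f. \<integral>x. f x * Z x \<partial>M) ` topspace ?T)"
    using image_compactin continuous_map_integral_dens[OF D(1) Z] compact_space_dens[OF assms(1)]
    unfolding compact_space_def by blast
  then have "compact ((\<lambda>f. \<integral>x. f x * Z x \<partial>M) ` dens M ` D)"
    unfolding compact_space_dens(2)[OF assms(1)] by simp
  also have "(\<lambda>f. \<integral>x. f x * Z x \<partial>M) ` dens M ` D = (\<lambda>Q. \<integral>x. Z x \<partial>Q) ` D"
    unfolding image_image using D(1) L1s_measurable[OF Z]
    by (intro image_cong refl integral_dens(2)[symmetric]) auto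
  finally show ?thesis
    using compact_attains_inf[of "(\<lambda>Q. \<integral>x. Z x \<partial>Q) ` D"] D(2) by auto
qed

text \<open>Tychonoff makes the product of the density sets compact, and the summed expectation is
  affine both in the measures and in the claims, so \<open>common_sublevel\<close> applies. Mixtures
  are required in \<open>mix\<close> only through the expectations that occur. The lemma serves all
  agents at once and a single agent.\<close>

lemma common_price:
  assumes I: "finite I"
    and D: "\<And>i. i \<in> I \<Longrightarrow> D i \<subseteq> ac_probs M"
    and comp: "\<And>i. i \<in> I \<Longrightarrow> weakly_compact M (D i)"
    and mix: "\<And>i Q Q' t. \<lbrakk>i \<in> I; Q \<in> D i; Q' \<in> D i; 0 \<le> t; t \<le> 1\<rbrakk>
      \<Longrightarrow> \<exists>R\<in>D i. \<forall>X\<in>L1s M (D i). (\<integral>x. X x \<partial>R) = (1 - t) * (\<integral>x. X x \<partial>Q) + t * (\<integral>x. X x \<partial>Q')"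
    and ne: "\<Z> \<noteq> {}"
    and Z: "\<And>Z i. \<lbrakk>Z \<in> \<Z>; i \<in> I\<rbrakk> \<Longrightarrow> Z i \<in> L1s M (D i)"
    and conv: "\<And>Z Z' t. \<lbrakk>Z \<in> \<Z>; Z' \<in> \<Z>; 0 \<le> t; t \<le> 1\<rbrakk>
      \<Longrightarrow> (\<lambda>i x. (1 - t) * Z i x + t * Z' i x) \<in> \<Z>"
    and low: "\<And>Z. Z \<in> \<Z> \<Longrightarrow> \<exists>Q. (\<forall>i\<in>I. Q i \<in> D i) \<and> (\<Sum>i\<in>I. \<integral>x. Z i x \<partial>Q i) \<le> c"
  shows "\<exists>Q. (\<forall>i\<in>I. Q i \<in> D i) \<and> (\<forall>Z\<in>\<Z>. (\<Sum>i\<in>I. \<integral>x. Z i x \<partial>Q i) \<le> c)"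
proof -
  define T where "T = product_topology (\<lambda>i. subtopology (weak_L1 M) (dens M ` D i)) I"
  define f where "f Z p = (\<Sum>i\<in>I. \<integral>x. p i x * Z i x \<partial>M)" for Z and p :: "_ \<Rightarrow> 'a \<Rightarrow> real"
  \<comment> \<open>Points of the product topology are extensional functions, hence the restriction
    to \<open>I\<close>.\<close>
  define d where "d Q = restrict (\<lambda>i. dens M (Q i)) I" for Q
  have top: "topspace T = (\<Pi>\<^sub>E i\<in>I. dens M ` D i)"
    unfolding T_def topspace_product_topology using compact_space_dens(2)[OF comp]
    by (intro PiE_cong) auto
  have dT: "d Q \<in> topspace T" if "\<forall>i\<in>I. Q i \<in> D i" for Q
    using that by (auto simp: top d_def)
  have dE: "\<exists>Q. (\<forall>i\<in>I. Q i \<in> D i) \<and> p = d Q" if "p \<in> topspace T" for p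
  proof -
    have "\<forall>i\<in>I. \<exists>Q. Q \<in> D i \<and> p i = dens M Q" using that by (auto simp: top)
    then obtain Q where "\<forall>i\<in>I. Q i \<in> D i \<and> p i = dens M (Q i)" by metis
    moreover from this have "p = d Q"
      using that by (intro extensionalityI[of p I]) (auto simp: top d_def PiE_iff)
    ultimately show ?thesis by blast
  qed
  have fd: "f Z (d Q) = (\<Sum>i\<in>I. \<integral>x. Z i x \<partial>Q i)" if "Z \<in> \<Z>" "\<forall>i\<in>I. Q i \<in> D i" for Z Q
    unfolding f_def d_def
    by (intro sum.cong refl)
      (use that D Z in \<open>auto intro!: integral_dens(2)[symmetric] L1s_measurable\<close>)
  have "\<exists>p\<in>topspace T. \<forall>h\<in>f ` \<Z>. h p \<le> c"
  proof (rule common_sublevel)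
    show "compact_space T"
      unfolding T_def compact_space_product_topology using compact_space_dens(1)[OF comp] by blast
    show "f ` \<Z> \<noteq> {}" using ne by simp
    fix h assume "h \<in> f ` \<Z>"
    then obtain Z' where Z': "Z' \<in> \<Z>" "h = f Z'" by blast
    have "continuous_map T euclideanreal (\<lambda>p. \<integral>x. p i x * Z' i x \<partial>M)" if "i \<in> I" for i
    proof -
      have "continuous_map T (subtopology (weak_L1 M) (dens M ` D i)) (\<lambda>p. p i)"
        unfolding T_def using that by (rule continuous_map_product_projection)
      from continuous_map_compose[OF this continuous_map_integral_dens[OF D[OF that] Z[OF Z'(1) that]]]
      show ?thesis by (simp add: o_def)
    qed
    then show "continuous_map T euclideanreal h"
      unfolding Z'(2) f_def[abs_def] using I by (intro continuous_map_sum) auto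
    obtain Q where "\<forall>i\<in>I. Q i \<in> D i" "(\<Sum>i\<in>I. \<integral>x. Z' i x \<partial>Q i) \<le> c" using low Z'(1) by blast
    then show "\<exists>p\<in>topspace T. h p \<le> c"
      using dT fd[OF Z'(1)] Z'(2) by (intro bexI[of _ "d Q"]) auto
  next
    fix p q and t :: real
    assume "p \<in> topspace T" "q \<in> topspace T" and t: "0 \<le> t" "t \<le> 1"
    then obtain Q Q' where Q: "\<forall>i\<in>I. Q i \<in> D i" "p = d Q" and Q': "\<forall>i\<in>I. Q' i \<in> D i" "q = d Q'"
      using dE by metis
    have "\<forall>i\<in>I. \<exists>R. R \<in> D i \<and>
        (\<forall>X\<in>L1s M (D i). (\<integral>x. X x \<partial>R) = (1 - t) * (\<integral>x. X x \<partial>Q i) + t * (\<integral>x. X x \<partial>Q' i))"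
      using mix[OF _ _ _ t] Q(1) Q'(1) by blast
    then obtain R where R: "\<forall>i\<in>I. R i \<in> D i"
      "\<And>i X. i \<in> I \<Longrightarrow> X \<in> L1s M (D i)
        \<Longrightarrow> (\<integral>x. X x \<partial>R i) = (1 - t) * (\<integral>x. X x \<partial>Q i) + t * (\<integral>x. X x \<partial>Q' i)"
      by metis
    have "f Z (d R) = (1 - t) * f Z p + t * f Z q" if "Z \<in> \<Z>" for Z
      unfolding Q(2) Q'(2) fd[OF that R(1)] fd[OF that Q(1)] fd[OF that Q'(1)]
      using R(2) Z[OF that] by (simp add: sum_distrib_left sum.distrib)
    then show "\<exists>r\<in>topspace T. \<forall>h\<in>f ` \<Z>. h r = (1 - t) * h p + t * h q"
      using dT[OF R(1)] by (intro bexI[of _ "d R"]) auto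
  next
    fix h1 h2 and t :: real
    assume "h1 \<in> f ` \<Z>" "h2 \<in> f ` \<Z>" and t: "0 \<le> t" "t \<le> 1"
    then obtain Z1 Z2 where Z12: "Z1 \<in> \<Z>" "Z2 \<in> \<Z>" "h1 = f Z1" "h2 = f Z2" by blast
    let ?Z = "\<lambda>i x. (1 - t) * Z1 i x + t * Z2 i x"
    have Z': "?Z \<in> \<Z>" using conv Z12 t by blast
    have "f ?Z p = (1 - t) * h1 p + t * h2 p" if p: "p \<in> topspace T" for p
    proof -
      obtain Q where Q: "\<forall>i\<in>I. Q i \<in> D i" "p = d Q" using dE[OF p] by blast
      have "(\<integral>x. ?Z i x \<partial>Q i) = (1 - t) * (\<integral>x. Z1 i x \<partial>Q i) + t * (\<integral>x. Z2 i x \<partial>Q i)" if "i \<in> I" for i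
        using L1s_integrable[OF D[OF that] Z[OF Z12(1) that]] L1s_integrable[OF D[OF that] Z[OF Z12(2) that]]
          Q(1) that by simp
      then show ?thesis
        unfolding Q(2) Z12(3,4) fd[OF Z' Q(1)] fd[OF Z12(1) Q(1)] fd[OF Z12(2) Q(1)]
        by (simp add: sum_distrib_left sum.distrib)
    qed
    then show "\<exists>h\<in>f ` \<Z>. \<forall>p\<in>topspace T. h p = (1 - t) * h1 p + t * h2 p" using Z' by blast
  qed
  then obtain p where "p \<in> topspace T" "\<forall>Z\<in>\<Z>. f Z p \<le> c" by blast
  moreover from this obtain Q where "\<forall>i\<in>I. Q i \<in> D i" "p = d Q" using dE by blast
  ultimately show ?thesis using fd by (intro exI[of _ Q]) auto
qed

end

text \<open>Every representing set consists of measures whose expectation dominates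
  \<open>u\<close>. Enlarging it to all such measures can only lower the infimum, and domination
  prevents it from falling below \<open>u\<close>; so the greatest representing set exists.\<close>

lemma determining_set_eq:
  assumes "coherent_utility P u"
  shows "determining_set P u = {Q \<in> ac_probs P. \<forall>X\<in>L0 P. u X \<le> expec Q X}" (is "_ = ?D")
    and "represents P u (determining_set P u)"
proof -
  obtain D where D: "represents P u D" using assms by (auto simp: coherent_utility_def)
  have sub: "D' \<subseteq> ?D" if "represents P u D'" for D'
    using that by (auto simp: represents_def intro: INF_lower)
  have "u X = (INF Q\<in>?D. expec Q X)" if "X \<in> L0 P" for X
  proof (rule antisym)
    show "u X \<le> (INF Q\<in>?D. expec Q X)" using that by (intro INF_greatest) auto
    have "(INF Q\<in>?D. expec Q X) \<le> (INF Q\<in>D. expec Q X)" using sub[OF D] by (rule INF_superset_mono) auto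
    then show "(INF Q\<in>?D. expec Q X) \<le> u X" using D that by (simp add: represents_def)
  qed
  moreover have "D \<noteq> {}" using D by (simp add: represents_def)
  with sub[OF D] have "?D \<noteq> {}" by blast
  ultimately have r: "represents P u ?D" unfolding represents_def by blast
  then show "determining_set P u = ?D"
    unfolding determining_set_def using sub by (intro Greatest_equality)
  with r show "represents P u (determining_set P u)" by simp
qed

context prob_space begin

text \<open>Membership is tested on all of \<open>L0\<close>, including claims that are not
  integrable. If the mixture gives such a claim the value \<open>-\<infinity>\<close>, one of the
  two negative parts is already infinite, and then \<open>u\<close> itself is
  \<open>-\<infinity>\<close>.\<close>

lemma determining_set_mixture:
  assumes u: "coherent_utility M u" and Q: "Q \<in> determining_set M u" and Q': "Q' \<in> determining_set M u"
    and t: "0 \<le> t" "t \<le> 1"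
  shows "\<exists>R\<in>determining_set M u. \<forall>X\<in>L1s M (determining_set M u).
    (\<integral>x. X x \<partial>R) = (1 - t) * (\<integral>x. X x \<partial>Q) + t * (\<integral>x. X x \<partial>Q')"
proof -
  note eq = determining_set_eq(1)[OF u]
  have D: "determining_set M u \<subseteq> ac_probs M" by (auto simp: eq)
  have ac: "Q \<in> ac_probs M" "Q' \<in> ac_probs M" using Q Q' D by auto
  consider "t = 0" | "t = 1" | "0 < t" "t < 1" using t by linarith
  then show ?thesis
  proof cases
    case 3
    obtain R where R: "R \<in> ac_probs M" and Rint: "\<And>X. X \<in> borel_measurable M \<Longrightarrow>
        (\<integral>\<^sup>+x. X x \<partial>R) = ennreal (1 - t) * (\<integral>\<^sup>+x. X x \<partial>Q) + ennreal t * (\<integral>\<^sup>+x. X x \<partial>Q')"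
      using ac_probs_mixture[OF ac 3] by blast
    have mi: "integrable R X \<longleftrightarrow> integrable Q X \<and> integrable Q' X"
      "integrable R X \<Longrightarrow> (\<integral>x. X x \<partial>R) = (1 - t) * (\<integral>x. X x \<partial>Q) + t * (\<integral>x. X x \<partial>Q')"
      if "X \<in> borel_measurable M" for X :: "'a \<Rightarrow> real"
      using mixture_integral[OF 3 _ ac R that] Rint by blast+
    have "u X \<le> expec R X" if "X \<in> L0 M" for X
    proof -
      have X[measurable]: "X \<in> borel_measurable M" using that by (simp add: L0_def)
      have le: "u X \<le> expec Q X" "u X \<le> expec Q' X" using Q Q' that by (auto simp: eq)
      show ?thesis
      proof (cases "integrable R X")
        case True
        then have i: "integrable Q X" "integrable Q' X" using mi(1)[OF X] by auto
        have e: "expec R X = ereal ((1 - t) * (\<integral>x. X x \<partial>Q) + t * (\<integral>x. X x \<partial>Q'))"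
          using expec_integrable[OF True] mi(2)[OF X True] by simp
        have q: "u X \<le> ereal (\<integral>x. X x \<partial>Q)" "u X \<le> ereal (\<integral>x. X x \<partial>Q')"
          using le i by (simp_all add: expec_integrable)
        show ?thesis
        proof (cases "u X")
          case (real r)
          then have "r \<le> (\<integral>x. X x \<partial>Q)" "r \<le> (\<integral>x. X x \<partial>Q')" using q by auto
          then have "(1 - t) * r + t * r \<le> (1 - t) * (\<integral>x. X x \<partial>Q) + t * (\<integral>x. X x \<partial>Q')"
            using 3 by (intro add_mono mult_left_mono) auto
          then show ?thesis using real e by (simp add: algebra_simps)
        qed (use q in auto)
      next
        case False
        have [measurable]: "X \<in> borel_measurable Q" "X \<in> borel_measurable Q'" "X \<in> borel_measurable R"
          using ac R X by (auto intro: borel_measurable_ac_probs)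
        have m: "(\<lambda>x. ennreal (max 0 (- X x))) \<in> borel_measurable M" by measurable
        show ?thesis
        proof (cases "(\<integral>\<^sup>+x. ennreal (max 0 (- X x)) \<partial>R) = \<infinity>")
          case True
          then have "(\<integral>\<^sup>+x. ennreal (max 0 (- X x)) \<partial>Q) = \<infinity> \<or> (\<integral>\<^sup>+x. ennreal (max 0 (- X x)) \<partial>Q') = \<infinity>"
            unfolding Rint[OF m] using 3 by (auto simp: ennreal_mult_eq_top_iff)
          then have "u X = - \<infinity>" using le by (auto simp: expec_def)
          then show ?thesis by simp
        next
          assume "(\<integral>\<^sup>+x. ennreal (max 0 (- X x)) \<partial>R) \<noteq> \<infinity>"
          then have "expec R X = \<infinity>" using expec_not_integrable[OF _ False] by simp
          then show ?thesis by simp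
        qed
      qed
    qed
    then have "R \<in> determining_set M u" using R by (simp add: eq)
    moreover have "(\<integral>x. X x \<partial>R) = (1 - t) * (\<integral>x. X x \<partial>Q) + t * (\<integral>x. X x \<partial>Q')"
      if "X \<in> L1s M (determining_set M u)" for X
      using mi(2)[OF L1s_measurable[OF that] L1s_integrable[OF D that calculation]] .
    ultimately show ?thesis by blast
  qed (use Q Q' in auto)
qed

text \<open>Claims in \<open>L1s\<close> are integrable under every member of the determining set,
  so the infimum of extended expectations is that of a weakly continuous real function on a compact
  set.\<close>

lemma utility_attained:
  assumes u: "coherent_utility M u" and comp: "weakly_compact M (determining_set M u)"
    and Z: "Z \<in> L1s M (determining_set M u)"
  shows "\<exists>Q\<in>determining_set M u. u Z = ereal (\<integral>x. Z x \<partial>Q)"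
proof -
  note eq = determining_set_eq[OF u]
  have D: "determining_set M u \<subseteq> ac_probs M" "determining_set M u \<noteq> {}"
    and uZ: "u Z = (INF Q\<in>determining_set M u. expec Q Z)"
    using eq(2) L1s_measurable[OF Z] by (auto simp: represents_def L0_def)
  obtain Q where Q: "Q \<in> determining_set M u"
    "\<And>Q'. Q' \<in> determining_set M u \<Longrightarrow> (\<integral>x. Z x \<partial>Q) \<le> (\<integral>x. Z x \<partial>Q')"
    using integral_attains_inf[OF comp D Z] by blast
  have "expec Q' Z = ereal (\<integral>x. Z x \<partial>Q')" if "Q' \<in> determining_set M u" for Q'
    using expec_integrable[OF L1s_integrable[OF D(1) Z that]] .
  then have "u Z = ereal (\<integral>x. Z x \<partial>Q)"
    unfolding uZ using Q by (intro antisym INF_lower2[OF Q(1)] INF_greatest) auto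
  then show ?thesis using Q(1) by blast
qed

end

section \<open>Equilibria\<close>

text \<open>The scaling argument behind every use of boundedness: it is applied to indicator trades,
  to rays in the cones and to claims of zero price.\<close>

lemma bounded_ray_le_0:
  fixes w d c :: real
  assumes "\<And>k. 0 \<le> k \<Longrightarrow> w + k * d \<le> c"
  shows "d \<le> 0"
proof (rule ccontr)
  assume "\<not> d \<le> 0"
  moreover from this obtain k where "c - w < of_nat k * d" using reals_Archimedean3[of d] by auto
  ultimately show False using assms[of "of_nat k"] by auto
qed

lemma rv_convex_cone_scale: "\<lbrakk>rv_convex_cone A; X \<in> A; 0 \<le> c\<rbrakk> \<Longrightarrow> (\<lambda>x. c * X x) \<in> A"
  and rv_convex_cone_0: "rv_convex_cone A \<Longrightarrow> (\<lambda>_. 0) \<in> A"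
  and rv_convex_cone_convex:
    "\<lbrakk>rv_convex_cone A; X \<in> A; Y \<in> A; 0 \<le> t; t \<le> 1\<rbrakk> \<Longrightarrow> (\<lambda>x. (1 - t) * X x + t * Y x) \<in> A"
  unfolding rv_convex_cone_def by auto

lemma utility_translate:
  assumes u: "coherent_utility P u" and X: "X \<in> borel_measurable P"
  shows "u (\<lambda>x. X x + a) = u X + ereal a"
proof -
  obtain D where D: "D \<subseteq> ac_probs P" "\<And>X. X \<in> L0 P \<Longrightarrow> u X = (INF Q\<in>D. expec Q X)"
    using u by (auto simp: coherent_utility_def represents_def)
  have le: "u X + ereal a \<le> u (\<lambda>x. X x + a)" if X: "X \<in> borel_measurable P" for X a
  proof -
    have "(\<lambda>x. X x + a) \<in> L0 P" "X \<in> L0 P" using X by (auto simp: L0_def)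
    moreover have "u X + ereal a \<le> expec Q (\<lambda>x. X x + a)" if Q: "Q \<in> D" for Q
    proof -
      have ac: "Q \<in> ac_probs P" using Q D by blast
      interpret Q: prob_space Q using ac_probsD(1)[OF ac] .
      have "expec Q (\<lambda>x. a + X x) = ereal a + expec Q X"
        using expec_add[of Q "\<lambda>_. a" X] borel_measurable_ac_probs[OF ac X] by (simp add: Q.prob_space)
      moreover have "u X \<le> expec Q X"
        using D(2)[of X] X INF_lower[OF Q, of "\<lambda>Q. expec Q X"] by (simp add: L0_def)
      ultimately show ?thesis using add_left_mono[of "u X" "expec Q X" "ereal a"] by (simp add: add.commute)
    qed
    ultimately show ?thesis using D(2)[of "\<lambda>x. X x + a"] by (simp add: INF_greatest)
  qed
  \<comment> \<open>The inequality already proved, applied to the translated claim and the shift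
    \<open>- a\<close>, yields the converse.\<close>
  have "u (\<lambda>x. X x + a) + ereal (- a) \<le> u (\<lambda>x. (X x + a) + - a)"
    by (intro le borel_measurable_add X borel_measurable_const)
  then have "u (\<lambda>x. X x + a) + ereal (- a) \<le> u X" by simp
  then have "u (\<lambda>x. X x + a) \<le> u X + ereal a"
    by (cases "u (\<lambda>x. X x + a)"; cases "u X") auto
  then show ?thesis using le[OF X, of a] by (rule antisym)
qed

lemma utility_cong_AE:
  assumes u: "coherent_utility P u" and X: "X \<in> borel_measurable P" "Y \<in> borel_measurable P"
    and XY: "AE x in P. X x = Y x"
  shows "u X = u Y"
proof -
  obtain D where D: "D \<subseteq> ac_probs P" "\<And>X. X \<in> L0 P \<Longrightarrow> u X = (INF Q\<in>D. expec Q X)"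
    using u by (auto simp: coherent_utility_def represents_def)
  have "expec Q X = expec Q Y" if "Q \<in> D" for Q
    using D(1) that by (intro expec_cong_AE AE_ac_probs[OF _ XY]) blast
  then show ?thesis using D(2) X by (simp add: L0_def)
qed

lemma prob_eqI:
  assumes "prob_space Q" "prob_space Q'" "sets Q = sets Q'"
    and "\<And>B. B \<in> sets Q \<Longrightarrow> measure Q B = measure Q' B"
  shows "Q = Q'"
proof -
  interpret Q: prob_space Q by fact
  interpret Q': prob_space Q' by fact
  show ?thesis
    using assms by (intro measure_eqI) (auto simp: Q.emeasure_eq_measure Q'.emeasure_eq_measure)
qed

lemma sum_ereal_not_MInf:
  fixes f :: "'i \<Rightarrow> ereal"
  assumes "\<And>i. i \<in> I \<Longrightarrow> f i \<noteq> - \<infinity>"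
  shows "sum f I \<noteq> - \<infinity>"
  using assms by (induction I rule: infinite_finite_induct) auto

section \<open>The economy and the bounds that a price puts on utilities\<close>

locale economy = prob_space M for M :: "'a measure" +
  fixes N :: nat and u :: "nat \<Rightarrow> ('a \<Rightarrow> real) \<Rightarrow> ereal"
    and A :: "nat \<Rightarrow> ('a \<Rightarrow> real) set" and W :: "nat \<Rightarrow> 'a \<Rightarrow> real"
  assumes N: "1 \<le> N"
    and coh: "\<And>n. n \<in> {1..N} \<Longrightarrow> coherent_utility M (u n)"
    and comp: "\<And>n. n \<in> {1..N} \<Longrightarrow> weakly_compact M (determining_set M (u n))"
    and A_L0: "\<And>n. n \<in> {1..N} \<Longrightarrow> A n \<subseteq> L0 M"
    and cone: "\<And>n. n \<in> {1..N} \<Longrightarrow> rv_convex_cone (A n)"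
    and cons: "\<And>n. n \<in> {1..N} \<Longrightarrow> consistent M (determining_set M (u n)) (A n)"
    and W: "\<And>n. n \<in> {1..N} \<Longrightarrow> W n \<in> L1s M (determining_set M (u n))"
    and fin: "max_total_utility M N u W A < \<infinity>"
begin

abbreviation "D n \<equiv> determining_set M (u n)"

definition "prices = (\<Inter>n\<in>{1..N}. D n \<inter> risk_neutral M (A n))"

text \<open>Summing agentwise integrals matches the bounds on individual utilities; on
  \<open>prices\<close> this is the expectation of the aggregate endowment, by
  \<open>expec_wealth\<close>.\<close>

definition "wealth Q = (\<Sum>n\<in>{1..N}. \<integral>x. W n x \<partial>Q)"

abbreviation "U \<equiv> utility u W"

lemma D_ac: "n \<in> {1..N} \<Longrightarrow> D n \<subseteq> ac_probs M"
  using determining_set_eq(1)[OF coh] by auto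

lemma common_ac: "common_set M N u \<subseteq> ac_probs M"
  using D_ac[of 1] N unfolding common_set_def by auto

lemma A_measurable: "n \<in> {1..N} \<Longrightarrow> X \<in> A n \<Longrightarrow> X \<in> borel_measurable M"
  using A_L0 by (auto simp: L0_def)

lemma W_integrable: "n \<in> {1..N} \<Longrightarrow> Q \<in> D n \<Longrightarrow> integrable Q (W n)"
  using L1s_integrable[OF D_ac W] by blast

lemma prices_iff: "Q \<in> prices \<longleftrightarrow> (\<forall>n\<in>{1..N}. Q \<in> D n \<and> Q \<in> risk_neutral M (A n))"
  by (auto simp: prices_def)

lemma prices_common: "Q \<in> prices \<Longrightarrow> Q \<in> common_set M N u"
  by (auto simp: prices_iff common_set_def)

lemma expec_wealth: "Q \<in> prices \<Longrightarrow> expec Q (\<lambda>x. \<Sum>n\<in>{1..N}. W n x) = ereal (wealth Q)"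
  using W_integrable by (subst expec_integrable) (auto simp: prices_iff wealth_def)

lemma feasible_measurable:
  assumes "feasible M N u A X Y" "n \<in> {1..N}"
  shows "X n \<in> borel_measurable M" "Y n \<in> borel_measurable M"
  using assms A_measurable by (auto simp: feasible_def dest: L1s_measurable)

lemma feasible_integrable:
  assumes "feasible M N u A X Y" "Q \<in> common_set M N u" "n \<in> {1..N}"
  shows "integrable Q (Y n)"
  using L1s_integrable[OF common_ac] assms by (auto simp: feasible_def)

lemma feasible_sum:
  assumes "feasible M N u A X Y" "Q \<in> common_set M N u"
  shows "(\<Sum>n\<in>{1..N}. \<integral>x. Y n x \<partial>Q) = 0"
proof -
  have "(\<Sum>n\<in>{1..N}. \<integral>x. Y n x \<partial>Q) = (\<integral>x. (\<Sum>n\<in>{1..N}. Y n x) \<partial>Q)"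
    using feasible_integrable[OF assms] by simp
  also have "\<dots> = (\<integral>x. 0 \<partial>Q)"
  proof (rule integral_cong_AE)
    have Q: "Q \<in> ac_probs M" using assms(2) common_ac by blast
    show "AE x in Q. (\<Sum>n\<in>{1..N}. Y n x) = 0"
      using assms(1) by (intro AE_ac_probs[OF Q]) (simp add: feasible_def)
    show "(\<lambda>x. \<Sum>n\<in>{1..N}. Y n x) \<in> borel_measurable Q"
      using feasible_integrable[OF assms] by auto
  qed simp
  finally show ?thesis by simp
qed

text \<open>\<open>Y\<close> is merely \<open>Q\<close>-integrable, so the bound also covers the
  whole Arrow-Debreu budget set. The expectation of \<open>X\<close> stays extended, and
  \<open>optimal_prices\<close> later reads off its value from this form.\<close>

lemma utility_le:
  assumes n: "n \<in> {1..N}" and Q: "Q \<in> D n" and X: "X \<in> A n" and Y: "integrable Q Y"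
  shows "U n X Y \<le> ereal ((\<integral>x. W n x \<partial>Q) + (\<integral>x. Y x \<partial>Q)) + expec Q X"
proof -
  have ac: "Q \<in> ac_probs M" using Q D_ac[OF n] by blast
  have mX: "X \<in> borel_measurable Q"
    using borel_measurable_ac_probs[OF ac] A_measurable[OF n X] .
  have mY: "Y \<in> borel_measurable M"
    using borel_measurable_integrable[OF Y] measurable_cong_sets[OF ac_probsD(2)[OF ac] refl] by blast
  note [measurable] = A_measurable[OF n X] mY L1s_measurable[OF W[OF n]]
  have "(\<lambda>x. W n x + X x + Y x) \<in> L0 M" by (simp add: L0_def)
  then have "U n X Y \<le> expec Q (\<lambda>x. W n x + X x + Y x)"
    using Q unfolding determining_set_eq(1)[OF coh[OF n]] utility_def by blast
  also have "(\<lambda>x. W n x + X x + Y x) = (\<lambda>x. (W n x + Y x) + X x)" by (simp add: algebra_simps)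
  also have "expec Q \<dots> = ereal (\<integral>x. W n x + Y x \<partial>Q) + expec Q X"
    using W_integrable[OF n Q] Y mX by (intro expec_add) auto
  also have "(\<integral>x. W n x + Y x \<partial>Q) = (\<integral>x. W n x \<partial>Q) + (\<integral>x. Y x \<partial>Q)"
    using W_integrable[OF n Q] Y by simp
  finally show ?thesis .
qed

lemma utility_le_neutral:
  assumes n: "n \<in> {1..N}" and Q: "Q \<in> D n" "Q \<in> risk_neutral M (A n)"
    and X: "X \<in> A n" and Y: "integrable Q Y"
  shows "U n X Y \<le> ereal ((\<integral>x. W n x \<partial>Q) + (\<integral>x. Y x \<partial>Q))"
proof -
  have "expec Q X \<le> 0" using Q(2) X by (simp add: risk_neutral_def)
  then have "ereal ((\<integral>x. W n x \<partial>Q) + (\<integral>x. Y x \<partial>Q)) + expec Q X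
      \<le> ereal ((\<integral>x. W n x \<partial>Q) + (\<integral>x. Y x \<partial>Q)) + 0"
    by (rule add_left_mono)
  then show ?thesis using utility_le[OF n Q(1) X Y] by simp
qed

text \<open>The only place where consistency enters: elements of \<open>A n\<close> outside \<open>L1s\<close> need not be tested.\<close>

lemma risk_neutralI:
  assumes n: "n \<in> {1..N}" and Q: "Q \<in> D n"
    and neg: "\<And>X. \<lbrakk>X \<in> A n; X \<in> L1s M (D n)\<rbrakk> \<Longrightarrow> (\<integral>x. X x \<partial>Q) \<le> 0"
  shows "Q \<in> risk_neutral M (A n)"
proof -
  obtain A' where A': "A' \<subseteq> A n \<inter> L1s M (D n)"
    "D n \<inter> risk_neutral M (A n) = D n \<inter> risk_neutral M A'"
    using cons[OF n] by (auto simp: consistent_def)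
  have "expec Q X \<le> 0" if "X \<in> A'" for X
  proof -
    have X: "X \<in> A n" "X \<in> L1s M (D n)" using that A'(1) by auto
    show ?thesis
      using neg[OF X] expec_integrable[OF L1s_integrable[OF D_ac[OF n] X(2) Q]] by simp
  qed
  then have "Q \<in> risk_neutral M A'" using Q D_ac[OF n] by (auto simp: risk_neutral_def)
  then show ?thesis using A'(2) Q by blast
qed

lemma total_utility_real:
  assumes "\<And>n. n \<in> {1..N} \<Longrightarrow> U n (X n) (Y n) = ereal (v n)"
  shows "total_utility N u W X Y = ereal (\<Sum>n\<in>{1..N}. v n)"
proof -
  have "(\<Sum>n\<in>{1..N}. U n (X n) (Y n)) = (\<Sum>n\<in>{1..N}. ereal (v n))"
    using assms by (intro sum.cong) auto
  then show ?thesis using assms by (auto simp: total_utility_def)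
qed

section \<open>Bounded trades and the existence of a minimising price\<close>

lemma total_utility_le_max:
  "feasible M N u A X Y \<Longrightarrow> total_utility N u W X Y \<le> max_total_utility M N u W A"
  unfolding max_total_utility_def by (intro Sup_upper) blast

text \<open>A bounded claim lies in \<open>L1s\<close> for every set of absolutely continuous
  measures. Such a trade is thus feasible in the economy and also regular over each
  \<open>D n\<close>, where the utility is attained by some measure.\<close>

lemma bounded_trade:
  assumes X: "\<And>n. n \<in> {1..N} \<Longrightarrow> X n \<in> A n \<inter> L1s M (D n)"
    and Y: "\<And>n. n \<in> {1..N} \<Longrightarrow> Y n \<in> borel_measurable M" "\<And>n. n \<in> {1..N} \<Longrightarrow> \<exists>c. \<forall>x. \<bar>Y n x\<bar> \<le> c"
      "\<And>x. (\<Sum>n\<in>{1..N}. Y n x) = 0"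
  shows "n \<in> {1..N} \<Longrightarrow> Y n \<in> L1s M (D n)"
    and "\<exists>Q. (\<forall>n\<in>{1..N}. Q n \<in> D n) \<and>
      ereal (\<Sum>n\<in>{1..N}. \<integral>x. W n x + X n x + Y n x \<partial>Q n) \<le> max_total_utility M N u W A"
proof -
  have Yb: "Y n \<in> L1s M E" if "n \<in> {1..N}" "E \<subseteq> ac_probs M" for n E
    using Y(2)[OF that(1)] L1s_bounded[OF that(2) Y(1)[OF that(1)]] by blast
  show YD: "Y n \<in> L1s M (D n)" if "n \<in> {1..N}" for n using Yb[OF that D_ac[OF that]] .
  have "\<forall>n\<in>{1..N}. \<exists>Q\<in>D n. U n (X n) (Y n) = ereal (\<integral>x. W n x + X n x + Y n x \<partial>Q)"
  proof
    fix n assume n: "n \<in> {1..N}"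
    have "(\<lambda>x. W n x + X n x + Y n x) \<in> L1s M (D n)"
      using X[OF n] by (intro L1s_add D_ac[OF n] W[OF n] YD[OF n]) auto
    from utility_attained[OF coh[OF n] comp[OF n] this]
    show "\<exists>Q\<in>D n. U n (X n) (Y n) = ereal (\<integral>x. W n x + X n x + Y n x \<partial>Q)"
      by (simp add: utility_def)
  qed
  then obtain Q where Q: "\<forall>n\<in>{1..N}. Q n \<in> D n \<and> U n (X n) (Y n) = ereal (\<integral>x. W n x + X n x + Y n x \<partial>Q n)"
    by metis
  have "feasible M N u A X Y"
    using X Yb[OF _ common_ac] Y(3) by (auto simp: feasible_def)
  from total_utility_le_max[OF this] Q
  show "\<exists>Q. (\<forall>n\<in>{1..N}. Q n \<in> D n) \<and>
      ereal (\<Sum>n\<in>{1..N}. \<integral>x. W n x + X n x + Y n x \<partial>Q n) \<le> max_total_utility M N u W A"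
    using total_utility_real[of X Y "\<lambda>n. \<integral>x. W n x + X n x + Y n x \<partial>Q n"]
    by (intro exI[of _ Q]) auto
qed

text \<open>The minimax theorem gives one measure per agent. Trading an indicator between two agents at
  arbitrary scale forces these measures to coincide, and scaling inside the cones makes the common
  measure risk neutral.\<close>

lemma minimal_price: "\<exists>Q\<in>prices. ereal (wealth Q) \<le> max_total_utility M N u W A"
proof -
  have zero: "(\<lambda>_. 0) \<in> A n \<inter> L1s M (D n)" if "n \<in> {1..N}" for n
    using rv_convex_cone_0[OF cone[OF that]] L1s_bounded[OF D_ac[OF that], of "\<lambda>_. 0" 0] by simp
  \<comment> \<open>Not trading at all has a finite total utility, which keeps the maximum above
    \<open>-\<infinity>\<close>.\<close>
  obtain v where "ereal v \<le> max_total_utility M N u W A"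
    using bounded_trade(2)[of "\<lambda>_ _. 0" "\<lambda>_ _. 0"] zero by auto
  then obtain m where m: "max_total_utility M N u W A = ereal m"
    using fin by (cases "max_total_utility M N u W A") auto
  \<comment> \<open>Regular claims and bounded transfers keep every payoff in
    \<open>L1s M (D n)\<close>, as \<open>common_price\<close> requires, and still leave enough
    trades to test the measures.\<close>
  define trade where "trade X Y \<longleftrightarrow> (\<forall>n\<in>{1..N}. X n \<in> A n \<inter> L1s M (D n)) \<and>
    (\<forall>n\<in>{1..N}. Y n \<in> borel_measurable M) \<and> (\<forall>n\<in>{1..N}. \<exists>c. \<forall>x. \<bar>Y n x\<bar> \<le> c) \<and>
    (\<forall>x. (\<Sum>n\<in>{1..N}. Y n x) = 0)" for X Y :: "nat \<Rightarrow> 'a \<Rightarrow> real"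
  define Z where "Z X Y = (\<lambda>n x. W n x + X n x + Y n x)" for X Y :: "nat \<Rightarrow> 'a \<Rightarrow> real"
  have trade_L1s: "Y n \<in> L1s M (D n)" if "trade X Y" "n \<in> {1..N}" for X Y n
    using bounded_trade(1)[of X Y n] that by (auto simp: trade_def)
  have trade_zero: "trade (\<lambda>_ _. 0) (\<lambda>_ _. 0)" using zero by (auto simp: trade_def)
  have "\<exists>Q. (\<forall>n\<in>{1..N}. Q n \<in> D n) \<and>
    (\<forall>Z\<in>{Z X Y |X Y. trade X Y}. (\<Sum>n\<in>{1..N}. \<integral>x. Z n x \<partial>Q n) \<le> m)"
  proof (rule common_price)
    show "{Z X Y |X Y. trade X Y} \<noteq> {}" using trade_zero by blast
    show "Z' n \<in> L1s M (D n)" if "Z' \<in> {Z X Y |X Y. trade X Y}" and n: "n \<in> {1..N}" for Z' n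
      using that trade_L1s[OF _ n]
      by (auto simp: Z_def trade_def intro!: L1s_add[OF D_ac[OF n]] W[OF n])
    show "\<exists>R\<in>D n. \<forall>X\<in>L1s M (D n). (\<integral>x. X x \<partial>R) = (1 - t) * (\<integral>x. X x \<partial>Q) + t * (\<integral>x. X x \<partial>Q')"
      if "n \<in> {1..N}" "Q \<in> D n" "Q' \<in> D n" "0 \<le> t" "t \<le> 1" for n Q Q' t
      using determining_set_mixture[OF coh] that by blast
    fix Z1 Z2 and t :: real assume "Z1 \<in> {Z X Y |X Y. trade X Y}" "Z2 \<in> {Z X Y |X Y. trade X Y}"
      and t: "0 \<le> t" "t \<le> 1"
    then obtain X1 Y1 X2 Y2 where 1: "trade X1 Y1" "Z1 = Z X1 Y1" and 2: "trade X2 Y2" "Z2 = Z X2 Y2"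
      by blast
    define X where "X n x = (1 - t) * X1 n x + t * X2 n x" for n x
    define Y where "Y n x = (1 - t) * Y1 n x + t * Y2 n x" for n x
    have "trade X Y"
      unfolding trade_def
    proof (intro conjI ballI allI)
      show "(\<Sum>n\<in>{1..N}. Y n x) = 0" for x
        using 1 2 by (simp add: Y_def trade_def sum.distrib flip: sum_distrib_left)
      fix n assume n: "n \<in> {1..N}"
      have X12: "X1 n \<in> A n" "X2 n \<in> A n" "X1 n \<in> L1s M (D n)" "X2 n \<in> L1s M (D n)"
        using 1 2 n by (auto simp: trade_def)
      have "X n \<in> A n" "X n \<in> L1s M (D n)" unfolding X_def[abs_def]
        by (rule rv_convex_cone_convex[OF cone[OF n] X12(1,2) t] L1s_lincomb[OF D_ac[OF n] X12(3,4)])+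
      then show "X n \<in> A n \<inter> L1s M (D n)" by blast
      have "Y1 n \<in> borel_measurable M" "Y2 n \<in> borel_measurable M"
        using 1 2 n by (auto simp: trade_def)
      then show "Y n \<in> borel_measurable M" unfolding Y_def[abs_def] by measurable
      have "\<exists>c. \<forall>x. \<bar>Y1 n x\<bar> \<le> c" "\<exists>c. \<forall>x. \<bar>Y2 n x\<bar> \<le> c"
        using 1(1) 2(1) n unfolding trade_def by blast+
      then obtain c1 c2 where c: "\<And>x. \<bar>Y1 n x\<bar> \<le> c1" "\<And>x. \<bar>Y2 n x\<bar> \<le> c2" by blast
      have "\<bar>Y n x\<bar> \<le> (1 - t) * c1 + t * c2" for x
      proof -
        have "\<bar>Y n x\<bar> \<le> \<bar>(1 - t) * Y1 n x\<bar> + \<bar>t * Y2 n x\<bar>" unfolding Y_def by (rule abs_triangle_ineq)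
        also have "\<dots> = (1 - t) * \<bar>Y1 n x\<bar> + t * \<bar>Y2 n x\<bar>" using t by (simp add: abs_mult)
        also have "\<dots> \<le> (1 - t) * c1 + t * c2" using c t by (intro add_mono mult_left_mono) auto
        finally show ?thesis .
      qed
      then show "\<exists>c. \<forall>x. \<bar>Y n x\<bar> \<le> c" by blast
    qed
    moreover have "(\<lambda>n x. (1 - t) * Z1 n x + t * Z2 n x) = Z X Y"
      by (simp add: 1 2 Z_def X_def Y_def fun_eq_iff algebra_simps)
    ultimately show "(\<lambda>n x. (1 - t) * Z1 n x + t * Z2 n x) \<in> {Z X Y |X Y. trade X Y}" by blast
  next
    fix Z' assume "Z' \<in> {Z X Y |X Y. trade X Y}"
    then obtain X Y where XY: "trade X Y" "Z' = Z X Y" by blast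
    have "\<exists>Q. (\<forall>n\<in>{1..N}. Q n \<in> D n) \<and>
      ereal (\<Sum>n\<in>{1..N}. \<integral>x. W n x + X n x + Y n x \<partial>Q n) \<le> max_total_utility M N u W A"
      using XY(1) by (intro bounded_trade(2)) (auto simp: trade_def)
    then show "\<exists>Q. (\<forall>n\<in>{1..N}. Q n \<in> D n) \<and> (\<Sum>n\<in>{1..N}. \<integral>x. Z' n x \<partial>Q n) \<le> m"
      unfolding XY(2) Z_def m by simp
  qed (use D_ac comp in auto)
  then obtain Q where Q: "\<And>n. n \<in> {1..N} \<Longrightarrow> Q n \<in> D n"
    and le: "\<And>X Y. trade X Y \<Longrightarrow> (\<Sum>n\<in>{1..N}. \<integral>x. Z X Y n x \<partial>Q n) \<le> m"
    by blast
  define w where "w = (\<Sum>n\<in>{1..N}. \<integral>x. W n x \<partial>Q n)"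
  have le': "w + (\<Sum>n\<in>{1..N}. \<integral>x. X n x \<partial>Q n) + (\<Sum>n\<in>{1..N}. \<integral>x. Y n x \<partial>Q n) \<le> m" if XY: "trade X Y" for X Y
  proof -
    have "(\<integral>x. Z X Y n x \<partial>Q n) = (\<integral>x. W n x \<partial>Q n) + (\<integral>x. X n x \<partial>Q n) + (\<integral>x. Y n x \<partial>Q n)"
      if n: "n \<in> {1..N}" for n
    proof -
      have "X n \<in> L1s M (D n)" using XY n by (auto simp: trade_def)
      then show ?thesis
        using W_integrable[OF n Q[OF n]] L1s_integrable[OF D_ac[OF n] _ Q[OF n]] trade_L1s[OF XY n]
        by (simp add: Z_def)
    qed
    then show ?thesis using le[OF XY] by (simp add: w_def sum.distrib)
  qed
  have ps: "prob_space (Q n)" and sets: "sets (Q n) = sets M" if "n \<in> {1..N}" for n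
    using ac_probsD(1,2) D_ac[OF that] Q[OF that] by blast+
  have Q_eq: "Q i = Q j" if i: "i \<in> {1..N}" and j: "j \<in> {1..N}" for i j
  proof (rule prob_eqI)
    fix B assume "B \<in> sets (Q i)"
    then have B[measurable]: "B \<in> sets M" using sets[OF i] by simp
    \<comment> \<open>Agent \<open>i\<close> receives what agent \<open>j\<close> pays; written as a
      difference, the weights also cover \<open>i = j\<close>, where nothing is traded.\<close>
    define a where "a n = (if n = i then 1 else 0) - (if n = j then 1 else 0 :: real)" for n
    have sum_a: "(\<Sum>n\<in>{1..N}. a n * y n) = y i - y j" for y
      using i j by (simp add: a_def left_diff_distrib sum_subtractf if_distrib[of "\<lambda>z. z * _"] cong: if_cong)
    have "w + k * (measure (Q i) B - measure (Q j) B) \<le> m" for k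
    proof -
      define Y where "Y n x = a n * (k * indicator B x)" for n x
      have "\<bar>Y n x\<bar> \<le> \<bar>a n\<bar> * \<bar>k\<bar>" for n x by (auto simp: Y_def indicator_def abs_mult)
      moreover have "Y n \<in> borel_measurable M" for n unfolding Y_def[abs_def] by measurable
      moreover have "(\<Sum>n\<in>{1..N}. Y n x) = 0" for x unfolding Y_def sum_a by simp
      ultimately have "trade (\<lambda>_ _. 0) Y" using zero by (auto simp: trade_def)
      from le'[OF this] have "w + (\<Sum>n\<in>{1..N}. \<integral>x. Y n x \<partial>Q n) \<le> m" by simp
      also have "(\<Sum>n\<in>{1..N}. \<integral>x. Y n x \<partial>Q n) = (\<Sum>n\<in>{1..N}. a n * (k * measure (Q n) B))"
      proof (rule sum.cong)
        fix n assume n: "n \<in> {1..N}"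
        interpret Qn: prob_space "Q n" using ps[OF n] .
        show "(\<integral>x. Y n x \<partial>Q n) = a n * (k * measure (Q n) B)"
          using B sets[OF n] by (simp add: Y_def)
      qed simp
      finally show ?thesis unfolding sum_a by (simp add: right_diff_distrib)
    qed
    \<comment> \<open>The scale \<open>k\<close> takes both signs, so neither difference of the two
      measures can be positive.\<close>
    then show "measure (Q i) B = measure (Q j) B"
      using bounded_ray_le_0[of w "measure (Q i) B - measure (Q j) B" m]
        bounded_ray_le_0[of w "- (measure (Q i) B - measure (Q j) B)" m]
      by (smt (verit) minus_mult_commute)
  qed (use ps sets i j in auto)
  define R where "R = Q 1"
  have QR: "Q n = R" if "n \<in> {1..N}" for n using Q_eq[OF that, of 1] N by (simp add: R_def)
  have "R \<in> prices"
    unfolding prices_iff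
  proof (intro ballI conjI)
    fix n assume n: "n \<in> {1..N}"
    show RD: "R \<in> D n" using Q[OF n] QR[OF n] by simp
    show "R \<in> risk_neutral M (A n)"
    proof (rule risk_neutralI[OF n RD])
      fix X assume X: "X \<in> A n" "X \<in> L1s M (D n)"
      have "w + k * (\<integral>x. X x \<partial>R) \<le> m" if k: "0 \<le> k" for k
      proof -
        \<comment> \<open>Only agent \<open>n\<close> moves, along a ray of its own cone, and all
          transfers vanish; the bound then restricts the expectation of \<open>X\<close>
          alone.\<close>
        define X' where "X' i x = (if i = n then k * X x else 0)" for i x
        have "X' i \<in> A i \<inter> L1s M (D i)" if i: "i \<in> {1..N}" for i
        proof (cases "i = n")
          case True
          then show ?thesis
            using rv_convex_cone_scale[OF cone[OF n] X(1) k] L1s_lincomb[OF D_ac[OF n] X(2) X(2), of k 0]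
            by (simp add: X'_def[abs_def])
        next
          case False
          then show ?thesis using zero[OF i] by (simp add: X'_def[abs_def])
        qed
        then have "trade X' (\<lambda>_ _. 0)" by (auto simp: trade_def)
        from le'[OF this] have "w + (\<Sum>i\<in>{1..N}. \<integral>x. X' i x \<partial>Q i) \<le> m" by simp
        also have "(\<Sum>i\<in>{1..N}. \<integral>x. X' i x \<partial>Q i) = (\<Sum>i\<in>{1..N}. if i = n then k * (\<integral>x. X x \<partial>R) else 0)"
          using QR by (intro sum.cong) (auto simp: X'_def)
        finally show ?thesis using n by simp
      qed
      then show "(\<integral>x. X x \<partial>R) \<le> 0" by (rule bounded_ray_le_0)
    qed
  qed
  moreover have "wealth R = w" using QR by (simp add: wealth_def w_def)
  moreover have "w \<le> m" using le'[OF trade_zero] by simp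
  ultimately show ?thesis using m by auto
qed

text \<open>One element of \<open>prices\<close> suffices as an upper bound, and
  \<open>minimal_price\<close> provides it; this is how finiteness of the maximum excludes infinite
  individual utilities.\<close>

lemma utility_lt_top:
  assumes n: "n \<in> {1..N}" and X: "X \<in> A n" and Y: "\<And>Q. Q \<in> prices \<Longrightarrow> integrable Q Y"
  shows "U n X Y < \<infinity>"
proof -
  obtain Q where Q: "Q \<in> prices" using minimal_price by blast
  then have "U n X Y \<le> ereal ((\<integral>x. W n x \<partial>Q) + (\<integral>x. Y x \<partial>Q))"
    using utility_le_neutral[OF n _ _ X Y[OF Q]] n by (auto simp: prices_iff)
  then show ?thesis by (rule order_le_less_trans) simp
qed

lemma feasible_utility_lt_top: "\<lbrakk>feasible M N u A X Y; n \<in> {1..N}\<rbrakk> \<Longrightarrow> U n (X n) (Y n) < \<infinity>"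
  using feasible_integrable prices_common
  by (intro utility_lt_top) (auto simp: feasible_def)

section \<open>Total utility, its dual bound and Pareto optimality\<close>

lemma total_utility_minf:
  "total_utility N u W X Y = - \<infinity> \<Longrightarrow> \<exists>n\<in>{1..N}. U n (X n) (Y n) = - \<infinity>"
proof (rule ccontr)
  assume t: "total_utility N u W X Y = - \<infinity>" and n: "\<not> (\<exists>n\<in>{1..N}. U n (X n) (Y n) = - \<infinity>)"
  then have "(\<Sum>n\<in>{1..N}. U n (X n) (Y n)) = - \<infinity>" by (simp add: total_utility_def)
  moreover have "(\<Sum>n\<in>{1..N}. U n (X n) (Y n)) \<noteq> - \<infinity>" using n by (intro sum_ereal_not_MInf) auto
  ultimately show False by blast
qed

lemma finite_total:
  assumes f: "feasible M N u A X Y" and t: "total_utility N u W X Y \<noteq> - \<infinity>"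
  obtains v where "\<And>n. n \<in> {1..N} \<Longrightarrow> U n (X n) (Y n) = ereal (v n)"
    "total_utility N u W X Y = ereal (\<Sum>n\<in>{1..N}. v n)"
proof -
  have "U n (X n) (Y n) = ereal (real_of_ereal (U n (X n) (Y n)))" if n: "n \<in> {1..N}" for n
  proof -
    have "U n (X n) (Y n) \<noteq> - \<infinity>" using t n by (auto simp: total_utility_def split: if_splits)
    then show ?thesis using feasible_utility_lt_top[OF f n] by (cases "U n (X n) (Y n)") auto
  qed
  from that[OF this total_utility_real[OF this]] show thesis .
qed

lemma utility_bound:
  assumes f: "feasible M N u A X Y" and Q: "Q \<in> prices" and n: "n \<in> {1..N}"
  shows "U n (X n) (Y n) \<le> ereal ((\<integral>x. W n x \<partial>Q) + (\<integral>x. Y n x \<partial>Q))"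
  using assms feasible_integrable[OF f prices_common[OF Q] n]
  by (intro utility_le_neutral) (auto simp: prices_iff feasible_def)

lemma sum_bound:
  assumes f: "feasible M N u A X Y" and Q: "Q \<in> prices"
  shows "(\<Sum>n\<in>{1..N}. (\<integral>x. W n x \<partial>Q) + (\<integral>x. Y n x \<partial>Q)) = wealth Q"
  using feasible_sum[OF f prices_common[OF Q]] by (simp add: sum.distrib wealth_def)

lemma total_utility_le_wealth:
  assumes f: "feasible M N u A X Y" and Q: "Q \<in> prices"
  shows "total_utility N u W X Y \<le> ereal (wealth Q)"
proof (cases "total_utility N u W X Y = - \<infinity>")
  case False
  then obtain v where v: "\<And>n. n \<in> {1..N} \<Longrightarrow> U n (X n) (Y n) = ereal (v n)"
    "total_utility N u W X Y = ereal (\<Sum>n\<in>{1..N}. v n)"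
    using finite_total[OF f] by blast
  have "v n \<le> (\<integral>x. W n x \<partial>Q) + (\<integral>x. Y n x \<partial>Q)" if "n \<in> {1..N}" for n
    using utility_bound[OF f Q that] v(1)[OF that] by simp
  then have "(\<Sum>n\<in>{1..N}. v n) \<le> wealth Q"
    unfolding sum_bound[OF f Q, symmetric] by (rule sum_mono)
  then show ?thesis using v(2) by simp
qed simp

lemma max_le_wealth: "Q \<in> prices \<Longrightarrow> max_total_utility M N u W A \<le> ereal (wealth Q)"
  unfolding max_total_utility_def by (intro Sup_least) (auto intro: total_utility_le_wealth)

text \<open>Duality without gap: \<open>max_le_wealth\<close> is the easy inequality,
  \<open>minimal_price\<close> gives the other one together with attainment.\<close>

lemma extreme_prices:
  "extreme_measures prices (\<lambda>x. \<Sum>n\<in>{1..N}. W n x)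
    = {Q \<in> prices. ereal (wealth Q) = max_total_utility M N u W A}"
proof -
  have "(INF Q\<in>prices. expec Q (\<lambda>x. \<Sum>n\<in>{1..N}. W n x)) = (INF Q\<in>prices. ereal (wealth Q))"
    by (intro INF_cong refl expec_wealth)
  also have "\<dots> = max_total_utility M N u W A"
  proof (rule antisym)
    obtain Q where "Q \<in> prices" "ereal (wealth Q) \<le> max_total_utility M N u W A"
      using minimal_price by blast
    then show "(INF Q\<in>prices. ereal (wealth Q)) \<le> max_total_utility M N u W A" by (rule INF_lower2)
    show "max_total_utility M N u W A \<le> (INF Q\<in>prices. ereal (wealth Q))"
      by (intro INF_greatest max_le_wealth)
  qed
  finally show ?thesis
    unfolding extreme_measures_def using expec_wealth by auto
qed

lemma max_real:
  obtains m where "max_total_utility M N u W A = ereal m"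
proof -
  obtain Q where "Q \<in> prices" "ereal (wealth Q) \<le> max_total_utility M N u W A"
    using minimal_price by blast
  then show thesis using fin that by (cases "max_total_utility M N u W A") auto
qed

lemma utility_shift:
  assumes n: "n \<in> {1..N}" and X: "X \<in> A n" and Y: "Y \<in> borel_measurable M"
    and Y': "Y' \<in> borel_measurable M" "AE x in M. Y' x = Y x + a"
  shows "U n X Y' = U n X Y + ereal a"
proof -
  note [measurable] = A_measurable[OF n X] Y Y'(1) L1s_measurable[OF W[OF n]]
  have "u n (\<lambda>x. W n x + X x + Y' x) = u n (\<lambda>x. (W n x + X x + Y x) + a)"
    using Y'(2) by (intro utility_cong_AE[OF coh[OF n]]) auto
  also have "\<dots> = u n (\<lambda>x. W n x + X x + Y x) + ereal a"
    by (intro utility_translate[OF coh[OF n]]) measurable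
  finally show ?thesis by (simp add: utility_def)
qed

lemma feasible_shift:
  assumes f: "feasible M N u A X Y" and a: "(\<Sum>n\<in>{1..N}. a n) = 0"
  shows "feasible M N u A X (\<lambda>n x. Y n x + a n)"
proof -
  have "(\<lambda>x. Y n x + a n) \<in> L1s M (common_set M N u)" if n: "n \<in> {1..N}" for n
  proof (rule L1s_add[OF common_ac])
    show "Y n \<in> L1s M (common_set M N u)" using f n by (simp add: feasible_def)
    show "(\<lambda>_. a n) \<in> L1s M (common_set M N u)"
      by (rule L1s_bounded[OF common_ac, of _ "\<bar>a n\<bar>"]) auto
  qed
  then show ?thesis using f a by (simp add: feasible_def sum.distrib)
qed

lemma total_utility_shift:
  assumes f: "feasible M N u A X Y" and f': "feasible M N u A X Y'" and s: "shift_equiv M N Y' Y"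
  shows "total_utility N u W X Y' = total_utility N u W X Y"
proof -
  obtain a where a: "(\<Sum>n\<in>{1..N}. a n) = 0" "\<And>n. n \<in> {1..N} \<Longrightarrow> AE x in M. Y' n x = Y n x + a n"
    using s by (auto simp: shift_equiv_def)
  have U': "U n (X n) (Y' n) = U n (X n) (Y n) + ereal (a n)" if n: "n \<in> {1..N}" for n
    using f n feasible_measurable[OF f n] feasible_measurable[OF f' n] a(2)[OF n]
    by (intro utility_shift) (auto simp: feasible_def)
  show ?thesis
  proof (cases "total_utility N u W X Y = - \<infinity>")
    case True
    then obtain n where "n \<in> {1..N}" "U n (X n) (Y n) = - \<infinity>"
      using total_utility_minf by blast
    then have "U n (X n) (Y' n) = - \<infinity>" using U' by simp
    then have "total_utility N u W X Y' = - \<infinity>"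
      using \<open>n \<in> {1..N}\<close> unfolding total_utility_def by auto
    then show ?thesis using True by simp
  next
    case False
    then obtain v where v: "\<And>n. n \<in> {1..N} \<Longrightarrow> U n (X n) (Y n) = ereal (v n)"
      "total_utility N u W X Y = ereal (\<Sum>n\<in>{1..N}. v n)"
      using finite_total[OF f] by blast
    have "total_utility N u W X Y' = ereal (\<Sum>n\<in>{1..N}. v n + a n)"
      using U' v(1) by (intro total_utility_real) simp
    then show ?thesis using v(2) a(1) by (simp add: sum.distrib)
  qed
qed

text \<open>If some allocation has a larger total, constants summing to zero redistribute its
  surplus equally, and every agent gains strictly. Conversely, a Pareto improvement of real
  utilities raises their sum above the maximum.\<close>

lemma pareto_iff:
  assumes f: "feasible M N u A X Y"
  shows "pareto_equilibrium M N u W A X Y \<longleftrightarrow> total_utility N u W X Y = max_total_utility M N u W A"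
proof
  assume P: "pareto_equilibrium M N u W A X Y"
  show "total_utility N u W X Y = max_total_utility M N u W A"
  proof (rule ccontr)
    assume "total_utility N u W X Y \<noteq> max_total_utility M N u W A"
    then have "total_utility N u W X Y < max_total_utility M N u W A"
      using total_utility_le_max[OF f] by simp
    then obtain X' Y' where f': "feasible M N u A X' Y'"
      and lt: "total_utility N u W X Y < total_utility N u W X' Y'"
      unfolding max_total_utility_def less_Sup_iff by blast
    from lt have "total_utility N u W X' Y' \<noteq> - \<infinity>" by auto
    then obtain v' where v': "\<And>n. n \<in> {1..N} \<Longrightarrow> U n (X' n) (Y' n) = ereal (v' n)"
      "total_utility N u W X' Y' = ereal (\<Sum>n\<in>{1..N}. v' n)"
      using finite_total[OF f'] by blast
    \<comment> \<open>Current utilities may be \<open>-\<infinity>\<close>, so the redistribution is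
      computed from real upper bounds \<open>w\<close> whose sum is still below the better
      total.\<close>
    have "\<exists>w. (\<forall>n\<in>{1..N}. U n (X n) (Y n) \<le> ereal (w n)) \<and> (\<Sum>n\<in>{1..N}. w n) < (\<Sum>n\<in>{1..N}. v' n)"
    proof (cases "total_utility N u W X Y = - \<infinity>")
      case False
      then obtain v where v: "\<And>n. n \<in> {1..N} \<Longrightarrow> U n (X n) (Y n) = ereal (v n)"
        "total_utility N u W X Y = ereal (\<Sum>n\<in>{1..N}. v n)"
        using finite_total[OF f] by blast
      then show ?thesis using lt v'(2) by (intro exI[of _ v]) auto
    next
      case True
      then obtain k where k: "k \<in> {1..N}" "U k (X k) (Y k) = - \<infinity>" using total_utility_minf by blast
      \<comment> \<open>\<open>real_of_ereal\<close> maps \<open>-\<infinity>\<close> to 0, which is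
        still an upper bound. Agent \<open>k\<close>, whose utility is \<open>-\<infinity>\<close>,
        accepts any real bound; its entry brings the sum of \<open>w\<close> to one less than the
        better total.\<close>
      define r where "r n = real_of_ereal (U n (X n) (Y n))" for n
      define w where "w n = (if n = k then (\<Sum>n\<in>{1..N}. v' n) - (\<Sum>n\<in>{1..N} - {k}. r n) - 1 else r n)" for n
      have "U n (X n) (Y n) \<le> ereal (w n)" if n: "n \<in> {1..N}" for n
        using feasible_utility_lt_top[OF f n] k(2) by (cases "U n (X n) (Y n)") (auto simp: w_def r_def)
      moreover have "(\<Sum>n\<in>{1..N}. w n) = (\<Sum>n\<in>{1..N}. v' n) - 1"
      proof -
        have "(\<Sum>n\<in>{1..N}. w n) = w k + (\<Sum>n\<in>{1..N} - {k}. w n)" using k(1) by (simp add: sum.remove)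
        also have "(\<Sum>n\<in>{1..N} - {k}. w n) = (\<Sum>n\<in>{1..N} - {k}. r n)"
          by (intro sum.cong) (auto simp: w_def)
        finally show ?thesis by (simp add: w_def)
      qed
      ultimately show ?thesis by (intro exI[of _ w]) auto
    qed
    then obtain w where w: "\<And>n. n \<in> {1..N} \<Longrightarrow> U n (X n) (Y n) \<le> ereal (w n)"
      "(\<Sum>n\<in>{1..N}. w n) < (\<Sum>n\<in>{1..N}. v' n)" by blast
    \<comment> \<open>\<open>d\<close> is an equal share of the surplus, and \<open>a n\<close>
      moves agent \<open>n\<close> from \<open>v' n\<close> to \<open>w n + d\<close>.\<close>
    define d where "d = ((\<Sum>n\<in>{1..N}. v' n) - (\<Sum>n\<in>{1..N}. w n)) / real N"
    define a where "a n = w n - v' n + d" for n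
    have d: "0 < d" using w(2) N by (simp add: d_def)
    have "(\<Sum>n\<in>{1..N}. a n) = 0" using N by (simp add: a_def sum.distrib sum_subtractf d_def)
    from feasible_shift[OF f' this] have f'': "feasible M N u A X' (\<lambda>n x. Y' n x + a n)" .
    have better: "U n (X n) (Y n) < U n (X' n) (\<lambda>x. Y' n x + a n)" if n: "n \<in> {1..N}" for n
    proof -
      have "U n (X' n) (\<lambda>x. Y' n x + a n) = U n (X' n) (Y' n) + ereal (a n)"
        using f' n feasible_measurable[OF f' n] by (intro utility_shift) (auto simp: feasible_def)
      also have "\<dots> = ereal (w n + d)" using v'(1)[OF n] by (simp add: a_def)
      finally have eq: "U n (X' n) (\<lambda>x. Y' n x + a n) = ereal (w n + d)" .
      have "ereal (w n) < ereal (w n + d)" using d by simp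
      with w(1)[OF n] show ?thesis unfolding eq by (rule order_le_less_trans)
    qed
    have "1 \<in> {1..N}" using N by simp
    with P f'' better show False
      unfolding pareto_equilibrium_def by (meson less_imp_le)
  qed
next
  assume eq: "total_utility N u W X Y = max_total_utility M N u W A"
  obtain m where m: "max_total_utility M N u W A = ereal m" by (rule max_real)
  then have "total_utility N u W X Y \<noteq> - \<infinity>" using eq by simp
  then obtain v where v: "\<And>n. n \<in> {1..N} \<Longrightarrow> U n (X n) (Y n) = ereal (v n)"
    "total_utility N u W X Y = ereal (\<Sum>n\<in>{1..N}. v n)"
    using finite_total[OF f] by blast
  show "pareto_equilibrium M N u W A X Y"
    unfolding pareto_equilibrium_def
  proof (intro conjI f notI, elim exE conjE)
    fix X' Y' assume f': "feasible M N u A X' Y'"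
      and ge: "\<forall>n\<in>{1..N}. U n (X n) (Y n) \<le> U n (X' n) (Y' n)"
      and gt: "\<exists>n\<in>{1..N}. U n (X n) (Y n) < U n (X' n) (Y' n)"
    have "U n (X' n) (Y' n) \<noteq> - \<infinity>" if "n \<in> {1..N}" for n using ge v(1) that by fastforce
    then have "total_utility N u W X' Y' \<noteq> - \<infinity>" using total_utility_minf by blast
    then obtain v' where v': "\<And>n. n \<in> {1..N} \<Longrightarrow> U n (X' n) (Y' n) = ereal (v' n)"
      "total_utility N u W X' Y' = ereal (\<Sum>n\<in>{1..N}. v' n)"
      using finite_total[OF f'] by blast
    have "(\<Sum>n\<in>{1..N}. v n) < (\<Sum>n\<in>{1..N}. v' n)"
      using ge gt v(1) v'(1) by (intro sum_strict_mono_ex1) auto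
    then show False using total_utility_le_max[OF f'] eq m v(2) v'(2) by simp
  qed
qed

text \<open>The bounds \<open>?b n\<close> of the individual utilities add up to
  \<open>wealth Q\<close>, which equals the total utility; nonnegative slacks with sum zero vanish.
  Inserting this equality into \<open>utility_le\<close> leaves
  \<open>0 \<le> expec Q (X n)\<close>, and risk neutrality gives the reverse inequality.\<close>

lemma optimal_prices:
  assumes f: "feasible M N u A X Y" and t: "total_utility N u W X Y = max_total_utility M N u W A"
    and Q: "Q \<in> prices" "ereal (wealth Q) = max_total_utility M N u W A" and n: "n \<in> {1..N}"
  shows "U n (X n) (Y n) = ereal ((\<integral>x. W n x \<partial>Q) + (\<integral>x. Y n x \<partial>Q))" and "expec Q (X n) = 0"
proof -
  let ?b = "\<lambda>n. (\<integral>x. W n x \<partial>Q) + (\<integral>x. Y n x \<partial>Q)"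
  have tQ: "total_utility N u W X Y = ereal (wealth Q)" using t Q(2) by simp
  then obtain v where v: "\<And>n. n \<in> {1..N} \<Longrightarrow> U n (X n) (Y n) = ereal (v n)"
    "total_utility N u W X Y = ereal (\<Sum>n\<in>{1..N}. v n)"
    using finite_total[OF f] by (metis MInfty_neq_ereal(1))
  have le: "v n \<le> ?b n" if "n \<in> {1..N}" for n
    using utility_bound[OF f Q(1) that] v(1)[OF that] by simp
  have "(\<Sum>n\<in>{1..N}. v n) = (\<Sum>n\<in>{1..N}. ?b n)" using v(2) tQ sum_bound[OF f Q(1)] by simp
  then have "(\<Sum>n\<in>{1..N}. ?b n - v n) = 0" by (simp only: sum_subtractf)
  then have "?b n - v n = 0"
    using sum_nonneg_eq_0_iff[of "{1..N}" "\<lambda>n. ?b n - v n"] le n by simp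
  then show eq: "U n (X n) (Y n) = ereal (?b n)" using v(1)[OF n] by simp
  have h: "X n \<in> A n" "Q \<in> D n" "Q \<in> risk_neutral M (A n)"
    using f Q(1) n by (auto simp: feasible_def prices_iff)
  have "ereal (?b n) \<le> ereal (?b n) + expec Q (X n)"
    using utility_le[OF n h(2,1) feasible_integrable[OF f prices_common[OF Q(1)] n]] unfolding eq .
  moreover have "expec Q (X n) \<le> 0" using h by (simp add: risk_neutral_def)
  ultimately show "expec Q (X n) = 0" by (cases "expec Q (X n)") auto
qed

text \<open>After recentring, the utility of agent \<open>n\<close> is the
  \<open>Q\<close>-expectation of \<open>W n\<close>. That is exactly the bound of
  \<open>utility_le_neutral\<close> for claims of zero price, so it is maximal over the budget
  set.\<close>

lemma optimal_arrow_debreu: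
  assumes f: "feasible M N u A X Y" and t: "total_utility N u W X Y = max_total_utility M N u W A"
    and Q: "Q \<in> prices" "ereal (wealth Q) = max_total_utility M N u W A"
  shows "\<exists>Y'. shift_equiv M N Y' Y \<and> arrow_debreu_equilibrium M N u W A X Y' Q"
proof -
  define e where "e n = (\<integral>x. Y n x \<partial>Q)" for n
  define Y' where "Y' = (\<lambda>n x. Y n x + - e n)"
  have ac: "Q \<in> ac_probs M" using Q(1) prices_common common_ac by blast
  interpret Q: prob_space Q using ac_probsD(1)[OF ac] .
  have e0: "(\<Sum>n\<in>{1..N}. - e n) = 0"
    using feasible_sum[OF f prices_common[OF Q(1)]] by (simp add: e_def sum_negf)
  have f': "feasible M N u A X Y'" unfolding Y'_def by (rule feasible_shift[OF f e0])
  have s: "shift_equiv M N Y' Y" unfolding shift_equiv_def Y'_def using e0 by (intro exI[of _ "\<lambda>n. - e n"]) auto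
  have t': "total_utility N u W X Y' = max_total_utility M N u W A"
    using total_utility_shift[OF f f' s] t by simp
  have iY: "integrable Q (Y n)" if "n \<in> {1..N}" for n
    using feasible_integrable[OF f prices_common[OF Q(1)] that] .
  have iY': "integrable Q (Y' n)" and eY': "(\<integral>x. Y' n x \<partial>Q) = 0" if "n \<in> {1..N}" for n
    using iY[OF that] by (auto simp: Y'_def e_def Q.prob_space)
  have exp0: "expec Q (Y' n) = 0" if "n \<in> {1..N}" for n
    using expec_integrable[OF iY'[OF that]] eY'[OF that] by (simp add: zero_ereal_def)
  have UY': "U n (X n) (Y' n) = ereal (\<integral>x. W n x \<partial>Q)" if n: "n \<in> {1..N}" for n
    using optimal_prices(1)[OF f' t' Q n] eY'[OF n] by simp
  have "U n (X n) (Y' n) \<in> attainable u W A Q n" if n: "n \<in> {1..N}" for n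
    unfolding attainable_def using f' iY'[OF n] exp0[OF n] n unfolding feasible_def by blast
  moreover have "v \<le> U n (X n) (Y' n)" if n: "n \<in> {1..N}" and v: "v \<in> attainable u W A Q n" for n v
  proof -
    obtain X1 Y1 where 1: "v = U n X1 Y1" "X1 \<in> A n" "integrable Q Y1" "expec Q Y1 = 0"
      using v by (auto simp: attainable_def)
    have "(\<integral>x. Y1 x \<partial>Q) = 0" using expec_integrable[OF 1(3)] 1(4) by (simp add: zero_ereal_def)
    then show ?thesis
      using utility_le_neutral[OF n _ _ 1(2,3)] Q(1) n UY'[OF n] 1(1) by (simp add: prices_iff)
  qed
  ultimately have "arrow_debreu_equilibrium M N u W A X Y' Q"
    unfolding arrow_debreu_equilibrium_def using ac f' exp0 by blast
  then show ?thesis using s by blast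
qed

section \<open>Prices recovered from bounded utility on a budget set\<close>

lemma zero_in_A: "n \<in> {1..N} \<Longrightarrow> (\<lambda>_. 0) \<in> A n"
  using rv_convex_cone_0[OF cone] .

text \<open>Boundedness on rays gives \<open>u n \<eta> \<le> 0\<close> for every bounded \<open>\<eta>\<close> with \<open>E\<^sub>Q \<eta> = 0\<close>. The minimax theorem for
  the single agent \<open>n\<close> turns this into one \<open>Q' \<in> D n\<close> with \<open>E\<^sub>Q\<^sub>' \<eta> \<le> 0\<close> for all these \<open>\<eta>\<close>, and so \<open>Q' = Q\<close>.\<close>

lemma price_in_determining_set:
  assumes n: "n \<in> {1..N}" and Q: "Q \<in> ac_probs M"
    and bound: "\<And>v. v \<in> attainable u W A Q n \<Longrightarrow> v \<le> ereal c"
  shows "Q \<in> D n"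
proof -
  interpret Q: prob_space Q using ac_probsD(1)[OF Q] .
  define H where "H = {\<eta> \<in> borel_measurable M. (\<exists>c::real. \<forall>x. \<bar>\<eta> x\<bar> \<le> c) \<and> (\<integral>x. \<eta> x \<partial>Q) = 0}"
  have HD: "\<eta> \<in> L1s M E" if "\<eta> \<in> H" "E \<subseteq> ac_probs M" for \<eta> E
    using that L1s_bounded[OF that(2)] unfolding H_def by blast
  \<comment> \<open>\<open>L1s\<close> over the singleton \<open>{Q}\<close> serves as an
    integrability criterion here.\<close>
  have HQ: "integrable Q \<eta>" if "\<eta> \<in> H" for \<eta>
    using L1s_integrable[OF _ HD[OF that], of "{Q}" Q] Q by simp
  have neg: "\<exists>Q'\<in>D n. (\<integral>x. \<eta> x \<partial>Q') \<le> 0" if \<eta>: "\<eta> \<in> H" for \<eta>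
  proof -
    note D = D_ac[OF n]
    obtain Q0 where Q0: "Q0 \<in> D n" "\<And>Q'. Q' \<in> D n \<Longrightarrow> (\<integral>x. \<eta> x \<partial>Q0) \<le> (\<integral>x. \<eta> x \<partial>Q')"
      using integral_attains_inf[OF comp[OF n] D _ HD[OF \<eta> D]] determining_set_eq(2)[OF coh[OF n]]
      unfolding represents_def by blast
    \<comment> \<open>The minimising measure \<open>Q2\<close> below varies with \<open>k\<close>.
      Bounding endowment and claim separately by their minima over \<open>D n\<close> leaves a fixed
      slope for the ray argument.\<close>
    obtain Q1 where Q1: "Q1 \<in> D n" "\<And>Q'. Q' \<in> D n \<Longrightarrow> (\<integral>x. W n x \<partial>Q1) \<le> (\<integral>x. W n x \<partial>Q')"
      using integral_attains_inf[OF comp[OF n] D _ W[OF n]] Q0(1) by blast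
    have "(\<integral>x. W n x \<partial>Q1) + k * (\<integral>x. \<eta> x \<partial>Q0) \<le> c" if k: "0 \<le> k" for k
    proof -
      have "(\<lambda>x. k * \<eta> x) \<in> L1s M (D n)" using L1s_lincomb[OF D HD[OF \<eta> D] HD[OF \<eta> D], of k 0] by simp
      from L1s_add[OF D W[OF n] this]
      obtain Q2 where Q2: "Q2 \<in> D n" "u n (\<lambda>x. W n x + k * \<eta> x) = ereal (\<integral>x. W n x + k * \<eta> x \<partial>Q2)"
        using utility_attained[OF coh[OF n] comp[OF n]] by blast
      have "integrable Q (\<lambda>x. k * \<eta> x)" "expec Q (\<lambda>x. k * \<eta> x) = 0"
        using HQ[OF \<eta>] \<eta> by (simp_all add: expec_integrable H_def zero_ereal_def)
      then have "U n (\<lambda>_. 0) (\<lambda>x. k * \<eta> x) \<in> attainable u W A Q n"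
        unfolding attainable_def using zero_in_A[OF n] by blast
      from bound[OF this] have "(\<integral>x. W n x + k * \<eta> x \<partial>Q2) \<le> c" using Q2(2) by (simp add: utility_def)
      moreover have "(\<integral>x. W n x + k * \<eta> x \<partial>Q2) = (\<integral>x. W n x \<partial>Q2) + k * (\<integral>x. \<eta> x \<partial>Q2)"
        using W_integrable[OF n Q2(1)] L1s_integrable[OF D HD[OF \<eta> D] Q2(1)] by simp
      moreover have "k * (\<integral>x. \<eta> x \<partial>Q0) \<le> k * (\<integral>x. \<eta> x \<partial>Q2)"
        using Q0(2)[OF Q2(1)] k by (rule mult_left_mono)
      ultimately show ?thesis using Q1(2)[OF Q2(1)] by linarith
    qed
    then have "(\<integral>x. \<eta> x \<partial>Q0) \<le> 0" by (rule bounded_ray_le_0)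
    then show ?thesis using Q0(1) by blast
  qed
  have "\<exists>Q'. (\<forall>i\<in>{n}. Q' i \<in> D i) \<and> (\<forall>Z\<in>(\<lambda>\<eta> _. \<eta>) ` H. (\<Sum>i\<in>{n}. \<integral>x. Z i x \<partial>Q' i) \<le> 0)"
  proof (rule common_price)
    have "(\<lambda>_. 0) \<in> H" by (auto simp: H_def)
    then show "(\<lambda>\<eta> _. \<eta>) ` H \<noteq> {}" by blast
    show "\<exists>R\<in>D i. \<forall>X\<in>L1s M (D i). (\<integral>x. X x \<partial>R) = (1 - t) * (\<integral>x. X x \<partial>Q) + t * (\<integral>x. X x \<partial>Q')"
      if "i \<in> {n}" "Q \<in> D i" "Q' \<in> D i" "0 \<le> t" "t \<le> 1" for i Q Q' t
      using determining_set_mixture[OF coh] that n by blast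
    show "(\<lambda>i x. (1 - t) * Z i x + t * Z' i x) \<in> (\<lambda>\<eta> _. \<eta>) ` H"
      if "Z \<in> (\<lambda>\<eta> _. \<eta>) ` H" "Z' \<in> (\<lambda>\<eta> _. \<eta>) ` H" and t: "0 \<le> t" "t \<le> 1" for Z Z' :: "nat \<Rightarrow> 'a \<Rightarrow> real" and t :: real
    proof -
      obtain a b where ab: "a \<in> H" "b \<in> H" and Z: "Z = (\<lambda>_. a)" "Z' = (\<lambda>_. b)"
        using \<open>Z \<in> _\<close> \<open>Z' \<in> _\<close> by blast
      have [measurable]: "a \<in> borel_measurable M" "b \<in> borel_measurable M" using ab by (auto simp: H_def)
      obtain ca cb where c: "\<And>x. \<bar>a x\<bar> \<le> ca" "\<And>x. \<bar>b x\<bar> \<le> cb" using ab unfolding H_def by blast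
      have "\<bar>(1 - t) * a x + t * b x\<bar> \<le> (1 - t) * ca + t * cb" for x
      proof -
        have "\<bar>(1 - t) * a x + t * b x\<bar> \<le> \<bar>(1 - t) * a x\<bar> + \<bar>t * b x\<bar>" by (rule abs_triangle_ineq)
        also have "\<dots> = (1 - t) * \<bar>a x\<bar> + t * \<bar>b x\<bar>" using t by (simp add: abs_mult)
        also have "\<dots> \<le> (1 - t) * ca + t * cb" using c t by (intro add_mono mult_left_mono) auto
        finally show ?thesis .
      qed
      moreover have "(\<integral>x. (1 - t) * a x + t * b x \<partial>Q) = 0"
        using HQ[OF ab(1)] HQ[OF ab(2)] ab by (simp add: H_def)
      ultimately have "(\<lambda>x. (1 - t) * a x + t * b x) \<in> H" unfolding H_def by auto
      then show ?thesis unfolding Z by blast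
    qed
    show "\<exists>Q'. (\<forall>i\<in>{n}. Q' i \<in> D i) \<and> (\<Sum>i\<in>{n}. \<integral>x. Z i x \<partial>Q' i) \<le> 0" if Z: "Z \<in> (\<lambda>\<eta> _. \<eta>) ` H" for Z
    proof -
      obtain \<eta> where "\<eta> \<in> H" "Z = (\<lambda>_. \<eta>)" using Z by blast
      moreover from this obtain Q' where "Q' \<in> D n" "(\<integral>x. \<eta> x \<partial>Q') \<le> 0" using neg by blast
      ultimately show ?thesis by (intro exI[of _ "\<lambda>_. Q'"]) simp
    qed
    show "Z i \<in> L1s M (D i)" if "Z \<in> (\<lambda>\<eta> _. \<eta>) ` H" "i \<in> {n}" for Z i
      using that HD D_ac n by auto
  qed (use n D_ac comp in auto)
  then obtain Q' where Q': "Q' \<in> D n" "\<And>\<eta>. \<eta> \<in> H \<Longrightarrow> (\<integral>x. \<eta> x \<partial>Q') \<le> 0" by auto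
  have ac': "Q' \<in> ac_probs M" using Q'(1) D_ac[OF n] by blast
  interpret Q': prob_space Q' using ac_probsD(1)[OF ac'] .
  note sets = ac_probsD(2)[OF Q] ac_probsD(2)[OF ac']
  have "Q = Q'"
  proof (rule prob_eqI[OF Q.prob_space_axioms Q'.prob_space_axioms])
    show "sets Q = sets Q'" using sets by simp
    fix B assume "B \<in> sets Q"
    then have B[measurable]: "B \<in> sets M" using sets by simp
    have iB: "integrable Q (indicator B :: 'a \<Rightarrow> real)" "integrable Q' (indicator B :: 'a \<Rightarrow> real)"
      using B sets
      by (auto intro!: integrable_real_indicator simp: Q.emeasure_eq_measure Q'.emeasure_eq_measure)
    \<comment> \<open>Indicators centred under \<open>Q\<close> belong to \<open>H\<close>; the
      values 1 and -1 of \<open>s\<close> give the two inequalities.\<close>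
    have "s * measure Q' B \<le> s * measure Q B" for s
    proof -
      have "(\<lambda>x. s * (indicator B x - measure Q B)) \<in> H"
        unfolding H_def
      proof (intro CollectI conjI)
        show "(\<lambda>x. s * (indicator B x - measure Q B)) \<in> borel_measurable M" by measurable
        have "\<bar>s * (indicator B x - measure Q B)\<bar> \<le> \<bar>s\<bar> * 1" for x
          unfolding abs_mult
          by (intro mult_left_mono) (use measure_nonneg[of Q B] Q.prob_le_1[of B] in \<open>auto simp: indicator_def\<close>)
        then show "\<exists>c. \<forall>x. \<bar>s * (indicator B x - measure Q B)\<bar> \<le> c" by blast
        show "(\<integral>x. s * (indicator B x - measure Q B) \<partial>Q) = 0"
          using B sets iB by (simp add: Q.prob_space)
      qed
      from Q'(2)[OF this] show ?thesis
        using B sets iB by (simp add: Q'.prob_space right_diff_distrib)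
    qed
    from this[of 1] this[of "-1"] show "measure Q B = measure Q' B" by simp
  qed
  then show ?thesis using Q'(1) by simp
qed

lemma utility_const: "n \<in> {1..N} \<Longrightarrow> u n (\<lambda>_. c) = ereal c"
proof -
  assume n: "n \<in> {1..N}"
  have "(\<lambda>_. c) \<in> L1s M (D n)" by (rule L1s_bounded[OF D_ac[OF n], of _ "\<bar>c\<bar>"]) auto
  then obtain Q where "Q \<in> D n" "u n (\<lambda>_. c) = ereal (\<integral>x. c \<partial>Q)"
    using utility_attained[OF coh[OF n] comp[OF n]] by blast
  moreover from this have "prob_space Q" using D_ac[OF n] ac_probsD(1) by blast
  ultimately show ?thesis by (simp add: prob_space.prob_space)
qed

text \<open>Membership in \<open>D n\<close> comes first: it makes \<open>W n\<close> integrable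
  under \<open>Q\<close>, so that hedging the endowment is an admissible purchase. A fully hedged
  position is constant, and its utility is known exactly.\<close>

lemma arrow_debreu_price:
  assumes n: "n \<in> {1..N}" and Q: "Q \<in> ac_probs M"
    and bound: "\<And>v. v \<in> attainable u W A Q n \<Longrightarrow> v \<le> ereal c"
  shows "Q \<in> D n" "Q \<in> risk_neutral M (A n)" "(\<integral>x. W n x \<partial>Q) \<le> c"
proof -
  interpret Q: prob_space Q using ac_probsD(1)[OF Q] .
  show QD: "Q \<in> D n" using price_in_determining_set[OF n Q bound] .
  have iW: "integrable Q (W n)" using W_integrable[OF n QD] .
  define w where "w = (\<integral>x. W n x \<partial>Q)"
  have "expec Q (\<lambda>x. w - W n x) = 0" "integrable Q (\<lambda>x. w - W n x)"
    using iW by (simp_all add: expec_integrable w_def zero_ereal_def Q.prob_space)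
  then have "U n (\<lambda>_. 0) (\<lambda>x. w - W n x) \<in> attainable u W A Q n"
    unfolding attainable_def using zero_in_A[OF n] by blast
  from bound[OF this] show "(\<integral>x. W n x \<partial>Q) \<le> c" by (simp add: utility_def utility_const[OF n] w_def)
  show "Q \<in> risk_neutral M (A n)"
  proof (rule risk_neutralI[OF n QD])
    fix X assume X: "X \<in> A n" "X \<in> L1s M (D n)"
    have iX: "integrable Q X" using L1s_integrable[OF D_ac[OF n] X(2) QD] .
    define e where "e = (\<integral>x. X x \<partial>Q)"
    have "w + k * e \<le> c" if k: "0 \<le> k" for k
    proof -
      \<comment> \<open>This claim cancels both \<open>W n\<close> and \<open>k * X\<close>, leaving
        the constant \<open>w + k * e\<close>; the constant is chosen to give the claim price
        zero.\<close>
      define \<eta> where "\<eta> x = w + k * e - W n x - k * X x" for x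
      have "integrable Q \<eta>" "expec Q \<eta> = 0"
        using iW iX by (simp_all add: \<eta>_def[abs_def] expec_integrable w_def e_def zero_ereal_def Q.prob_space)
      then have "U n (\<lambda>x. k * X x) \<eta> \<in> attainable u W A Q n"
        unfolding attainable_def using rv_convex_cone_scale[OF cone[OF n] X(1) k] by blast
      from bound[OF this] show ?thesis by (simp add: utility_def \<eta>_def utility_const[OF n])
    qed
    then show "(\<integral>x. X x \<partial>Q) \<le> 0" unfolding e_def by (rule bounded_ray_le_0)
  qed
qed

text \<open>The chain \<open>wealth Q\<close>, total utility of the equilibrium, maximal total
  utility, \<open>wealth Q\<close> is increasing, so all its members coincide. Shifts by constants
  with sum zero carry the total from \<open>Y'\<close> back to \<open>Y\<close>.\<close>

lemma arrow_debreu_optimal: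
  assumes f: "feasible M N u A X Y" and s: "shift_equiv M N Y' Y"
    and ad: "arrow_debreu_equilibrium M N u W A X Y' Q"
  shows "Q \<in> prices" "ereal (wealth Q) = max_total_utility M N u W A"
    "total_utility N u W X Y = max_total_utility M N u W A"
proof -
  have Q: "Q \<in> ac_probs M" and f': "feasible M N u A X Y'"
    and bound: "\<And>n v. n \<in> {1..N} \<Longrightarrow> v \<in> attainable u W A Q n \<Longrightarrow> v \<le> U n (X n) (Y' n)"
    using ad unfolding arrow_debreu_equilibrium_def by blast+
  interpret Q: prob_space Q using ac_probsD(1)[OF Q] .
  \<comment> \<open>Doing nothing is attainable and its utility \<open>u n (W n)\<close> is real,
    which bounds the equilibrium utility from below; feasibility keeps it below
    \<open>\<infinity>\<close>.\<close>
  have "\<exists>c. U n (X n) (Y' n) = ereal c" if n: "n \<in> {1..N}" for n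
  proof -
    have "integrable Q (\<lambda>_. 0)" "expec Q (\<lambda>_. 0) = 0" by (simp_all add: expec_integrable zero_ereal_def)
    then have "U n (\<lambda>_. 0) (\<lambda>_. 0) \<in> attainable u W A Q n"
      unfolding attainable_def using zero_in_A[OF n] by blast
    from bound[OF n this] have "u n (W n) \<le> U n (X n) (Y' n)" by (simp add: utility_def)
    moreover obtain Q0 where "u n (W n) = ereal (\<integral>x. W n x \<partial>Q0)"
      using utility_attained[OF coh[OF n] comp[OF n] W[OF n]] by blast
    ultimately show ?thesis
      using feasible_utility_lt_top[OF f' n] by (cases "U n (X n) (Y' n)") auto
  qed
  then obtain c where c: "\<And>n. n \<in> {1..N} \<Longrightarrow> U n (X n) (Y' n) = ereal (c n)" by metis
  have "v \<le> ereal (c n)" if "n \<in> {1..N}" "v \<in> attainable u W A Q n" for n v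
    using bound[OF that] c[OF that(1)] by simp
  note price = arrow_debreu_price[OF _ Q this]
  show prices: "Q \<in> prices" using price(1,2) by (simp add: prices_iff)
  have "wealth Q \<le> (\<Sum>n\<in>{1..N}. c n)" unfolding wealth_def using price(3) by (intro sum_mono)
  then have "ereal (wealth Q) \<le> total_utility N u W X Y'"
    using total_utility_real[of X Y' c] c by simp
  then show "ereal (wealth Q) = max_total_utility M N u W A"
    "total_utility N u W X Y = max_total_utility M N u W A"
    using total_utility_le_max[OF f'] max_le_wealth[OF prices] total_utility_shift[OF f f' s] by auto
qed

text \<open>The condition on \<open>Q\<close> is separated from the condition on the allocation: the
  equilibrium prices are either all minimisers of \<open>wealth\<close> or none.\<close>

lemma equilibrium_prices_eq:
  assumes f: "feasible M N u A X Y"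
  shows "equilibrium_prices M N u W A X Y =
    {Q \<in> prices. ereal (wealth Q) = max_total_utility M N u W A
      \<and> total_utility N u W X Y = max_total_utility M N u W A}"
proof (intro set_eqI iffI)
  fix Q assume "Q \<in> equilibrium_prices M N u W A X Y"
  then obtain Y' where "shift_equiv M N Y' Y" "arrow_debreu_equilibrium M N u W A X Y' Q"
    by (auto simp: equilibrium_prices_def)
  from arrow_debreu_optimal[OF f this] show "Q \<in> {Q \<in> prices. ereal (wealth Q) = max_total_utility M N u W A
      \<and> total_utility N u W X Y = max_total_utility M N u W A}" by blast
next
  fix Q assume "Q \<in> {Q \<in> prices. ereal (wealth Q) = max_total_utility M N u W A
      \<and> total_utility N u W X Y = max_total_utility M N u W A}"
  then show "Q \<in> equilibrium_prices M N u W A X Y"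
    using optimal_arrow_debreu[OF f] prices_common common_ac by (auto simp: equilibrium_prices_def)
qed

text \<open>The set of minimisers is nonempty by \<open>minimal_price\<close>, so only the condition
  on the allocation decides.\<close>

lemma pareto_iff_prices:
  assumes f: "feasible M N u A X Y"
  shows "pareto_equilibrium M N u W A X Y \<longleftrightarrow> equilibrium_prices M N u W A X Y \<noteq> {}"
proof -
  obtain Q where Q: "Q \<in> prices" "ereal (wealth Q) \<le> max_total_utility M N u W A"
    using minimal_price by blast
  then have "ereal (wealth Q) = max_total_utility M N u W A" using max_le_wealth by (intro antisym)
  then show ?thesis
    unfolding pareto_iff[OF f] equilibrium_prices_eq[OF f] using Q(1) by blast
qed

text \<open>From left to right, the equalities of \<open>optimal_prices\<close> say that
  \<open>Q\<close> attains each infimum. From right to left, linearity makes \<open>X n\<close> cost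
  nothing, so the attained values add up to \<open>wealth Q\<close>, which is at least the
  maximum.\<close>

lemma linear_equilibrium_prices:
  assumes f: "feasible M N u A X Y" and lin: "\<And>n. n \<in> {1..N} \<Longrightarrow> rv_linear_space (A n)"
  shows "equilibrium_prices M N u W A X Y =
    (\<Inter>n\<in>{1..N}. extreme_measures (D n) (\<lambda>x. W n x + X n x + Y n x) \<inter> risk_neutral M (A n))"
    (is "_ = (\<Inter>n\<in>_. ?E n)")
proof (intro set_eqI iffI)
  fix Q assume "Q \<in> equilibrium_prices M N u W A X Y"
  then have Q: "Q \<in> prices" "ereal (wealth Q) = max_total_utility M N u W A"
    and t: "total_utility N u W X Y = max_total_utility M N u W A"
    by (auto simp: equilibrium_prices_eq[OF f])
  have "Q \<in> ?E n" if n: "n \<in> {1..N}" for n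
  proof -
    let ?Z = "\<lambda>x. W n x + X n x + Y n x"
    note opt = optimal_prices[OF f t Q n]
    have h: "Q \<in> D n" "Q \<in> risk_neutral M (A n)" "X n \<in> A n"
      using Q(1) n f by (auto simp: prices_iff feasible_def)
    have ac: "Q \<in> ac_probs M" using h(1) D_ac[OF n] by blast
    have i: "integrable Q (\<lambda>x. W n x + Y n x)"
      using W_integrable[OF n h(1)] feasible_integrable[OF f prices_common[OF Q(1)] n] by simp
    have "?Z = (\<lambda>x. (W n x + Y n x) + X n x)" by (simp add: algebra_simps)
    then have "expec Q ?Z = ereal (\<integral>x. W n x + Y n x \<partial>Q) + expec Q (X n)"
      using expec_add[OF i borel_measurable_ac_probs[OF ac A_measurable[OF n h(3)]]] by simp
    also have "\<dots> = U n (X n) (Y n)"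
      using opt W_integrable[OF n h(1)] feasible_integrable[OF f prices_common[OF Q(1)] n] by simp
    finally have eq: "expec Q ?Z = U n (X n) (Y n)" .
    have "?Z \<in> L0 M"
      using A_measurable[OF n h(3)] feasible_measurable[OF f n] L1s_measurable[OF W[OF n]]
      by (simp add: L0_def)
    then have "U n (X n) (Y n) = (INF Q\<in>D n. expec Q ?Z)"
      using determining_set_eq(2)[OF coh[OF n]] by (simp add: represents_def utility_def)
    then have "expec Q ?Z = (INF Q\<in>D n. expec Q ?Z)" using eq by simp
    moreover have "- \<infinity> < expec Q ?Z" "expec Q ?Z < \<infinity>" unfolding eq opt(1) by simp_all
    ultimately show ?thesis using h unfolding extreme_measures_def by blast
  qed
  then show "Q \<in> (\<Inter>n\<in>{1..N}. ?E n)" by blast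
next
  fix Q assume Q: "Q \<in> (\<Inter>n\<in>{1..N}. ?E n)"
  then have prices: "Q \<in> prices" by (auto simp: prices_iff extreme_measures_def)
  have "U n (X n) (Y n) = ereal ((\<integral>x. W n x \<partial>Q) + (\<integral>x. Y n x \<partial>Q))" if n: "n \<in> {1..N}" for n
  proof -
    let ?Z = "\<lambda>x. W n x + X n x + Y n x"
    have h: "Q \<in> D n" "Q \<in> risk_neutral M (A n)" "X n \<in> A n"
      using prices n f by (auto simp: prices_iff feasible_def)
    have ac: "Q \<in> ac_probs M" using h(1) D_ac[OF n] by blast
    have EQ: "Q \<in> extreme_measures (D n) ?Z" using Q n by blast
    have E: "expec Q ?Z = (INF Q\<in>D n. expec Q ?Z)" "- \<infinity> < expec Q ?Z" "expec Q ?Z < \<infinity>"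
      using EQ unfolding extreme_measures_def by blast+
    have "?Z \<in> L0 M"
      using A_measurable[OF n h(3)] feasible_measurable[OF f n] L1s_measurable[OF W[OF n]]
      by (simp add: L0_def)
    then have UZ: "U n (X n) (Y n) = expec Q ?Z"
      unfolding E(1) using determining_set_eq(2)[OF coh[OF n]] by (simp add: represents_def utility_def)
    have iW: "integrable Q (W n)" and iY: "integrable Q (Y n)"
      using W_integrable[OF n h(1)] feasible_integrable[OF f prices_common[OF prices] n] .
    have iZ: "integrable Q ?Z"
      using \<open>?Z \<in> L0 M\<close> E(2,3)
      by (intro integrable_of_expec_finite borel_measurable_ac_probs[OF ac]) (simp_all add: L0_def)
    have iX: "integrable Q (X n)"
      using Bochner_Integration.integrable_diff[OF iZ Bochner_Integration.integrable_add[OF iW iY]]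
      by (simp add: algebra_simps)
    \<comment> \<open>Risk neutrality for both \<open>X n\<close> and its negative forces
      expectation zero.\<close>
    have "(\<lambda>x. - 1 * X n x) \<in> A n" using lin[OF n] h(3) unfolding rv_linear_space_def by blast
    then have "expec Q (X n) \<le> 0" "expec Q (\<lambda>x. - 1 * X n x) \<le> 0"
      using h(2,3) unfolding risk_neutral_def by blast+
    then have "(\<integral>x. X n x \<partial>Q) = 0" using iX by (simp add: expec_integrable)
    then show ?thesis using expec_integrable[OF iZ] UZ iW iX iY by simp
  qed
  from total_utility_real[of X Y "\<lambda>n. (\<integral>x. W n x \<partial>Q) + (\<integral>x. Y n x \<partial>Q)", OF this]
  have "total_utility N u W X Y = ereal (wealth Q)" using sum_bound[OF f prices] by simp
  then show "Q \<in> equilibrium_prices M N u W A X Y"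
    using prices max_le_wealth[OF prices] total_utility_le_max[OF f]
    by (auto simp: equilibrium_prices_eq[OF f])
qed

end

theorem theorem4p7:
  fixes P :: "'a measure" and N :: nat
    and u :: "nat \<Rightarrow> ('a \<Rightarrow> real) \<Rightarrow> ereal"
    and A :: "nat \<Rightarrow> ('a \<Rightarrow> real) set"
    and W X Y :: "nat \<Rightarrow> 'a \<Rightarrow> real"
  assumes "prob_space P" and "N \<ge> 1"
    and "\<And>n. n \<in> {1..N} \<Longrightarrow> coherent_utility P (u n)"
    and "\<And>n. n \<in> {1..N} \<Longrightarrow> weakly_compact P (determining_set P (u n))"
    and "\<And>n. n \<in> {1..N} \<Longrightarrow> A n \<subseteq> L0 P"
    and "\<And>n. n \<in> {1..N} \<Longrightarrow> rv_convex_cone (A n)"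
    and "\<And>n. n \<in> {1..N} \<Longrightarrow> consistent P (determining_set P (u n)) (A n)"
    and "\<And>n. n \<in> {1..N} \<Longrightarrow> W n \<in> L1s P (determining_set P (u n))"
    and "max_total_utility P N u W A < \<infinity>"
    and "\<And>n. n \<in> {1..N} \<Longrightarrow> X n \<in> A n"
    and "\<And>n. n \<in> {1..N} \<Longrightarrow> Y n \<in> L1s P (\<Inter>k\<in>{1..N}. determining_set P (u k))"
    and "AE x in P. (\<Sum>n\<in>{1..N}. Y n x) = 0"
  shows
    "(pareto_equilibrium P N u W A X Y \<longleftrightarrow>
        (\<exists>Q\<in>ac_probs P. \<exists>Y'. shift_equiv P N Y' Y \<and> arrow_debreu_equilibrium P N u W A X Y' Q))
     \<and> (pareto_equilibrium P N u W A X Y \<longrightarrow>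
        equilibrium_prices P N u W A X Y =
          extreme_measures (\<Inter>n\<in>{1..N}. determining_set P (u n) \<inter> risk_neutral P (A n))
            (\<lambda>x. \<Sum>n\<in>{1..N}. W n x))
     \<and> ((\<forall>n\<in>{1..N}. rv_linear_space (A n)) \<longrightarrow>
        (pareto_equilibrium P N u W A X Y \<longleftrightarrow>
          (\<Inter>n\<in>{1..N}. extreme_measures (determining_set P (u n)) (\<lambda>x. W n x + X n x + Y n x)
             \<inter> risk_neutral P (A n)) \<noteq> {})
        \<and> equilibrium_prices P N u W A X Y =
          (\<Inter>n\<in>{1..N}. extreme_measures (determining_set P (u n)) (\<lambda>x. W n x + X n x + Y n x)
             \<inter> risk_neutral P (A n)))"
proof -
  interpret prob_space P by fact
  interpret economy P N u A W
    by unfold_locales (use assms in auto)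
  have f: "feasible P N u A X Y"
    using assms(10-12) by (simp add: feasible_def common_set_def)
  have "pareto_equilibrium P N u W A X Y \<longleftrightarrow>
      (\<exists>Q\<in>ac_probs P. \<exists>Y'. shift_equiv P N Y' Y \<and> arrow_debreu_equilibrium P N u W A X Y' Q)"
    unfolding pareto_iff_prices[OF f] equilibrium_prices_def by blast
  \<comment> \<open>Under Pareto optimality the condition on the total utility holds, so only the
    minimality of \<open>Q\<close> remains.\<close>
  moreover have "equilibrium_prices P N u W A X Y =
      extreme_measures (\<Inter>n\<in>{1..N}. D n \<inter> risk_neutral P (A n)) (\<lambda>x. \<Sum>n\<in>{1..N}. W n x)"
    if "pareto_equilibrium P N u W A X Y"
    using that unfolding extreme_prices[unfolded prices_def] equilibrium_prices_eq[OF f] pareto_iff[OF f]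
    by (simp add: prices_def)
  moreover have "equilibrium_prices P N u W A X Y =
      (\<Inter>n\<in>{1..N}. extreme_measures (D n) (\<lambda>x. W n x + X n x + Y n x) \<inter> risk_neutral P (A n))"
    if "\<forall>n\<in>{1..N}. rv_linear_space (A n)"
    using that by (intro linear_equilibrium_prices[OF f]) blast
  moreover note pareto_iff_prices[OF f]
  ultimately show ?thesis by (intro conjI impI) (blast | simp only:)+
qed

end
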